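(* For any $S=\begin{pmatrix} a & b\\ c& d\end{pmatrix}\in GL_2(\mathbb{Z})$, the family $\{G_n^{S,S^{\top}}\}_{n\ge2}$ is an expander family if and only if $(a+d)(b-c)\neq 0$.
   Context: $S^{\top}$ denotes the transpose of $S$. For $S,T\in GL_2(\mathbb{Z})$ and $n\ge 2$, $G_n^{S,T}=(V_n,E_n^{S,T})$ is the undirected graph with vertex set $V_n=(\mathbb{Z}/n\mathbb{Z})^2$ in which every $(x,y)\in V_n$ is joined by an edge to each of $(x\pm1,y)$, $(x,y\pm1)$, $S(x,y)$, $S^{-1}(x,y)$, $T(x,y)$, $T^{-1}(x,y)$ (arithmetic modulo $n$). For a finite graph $G=(V,E)$, $\lambda_2(G)$ is the minimum of $\frac{\sum_{\{u,v\}\in E}|f(u)-f(v)|^2}{\sum_{u\in V}|f(u)|^2}$ over nonzero $f:V\to\mathbb{C}$ with $\sum_{u\in V}f(u)=0$. An infinite family $\{G_n\}$ of finite graphs with uniformly bounded degrees is an expander family if there is a constant $c>0$ with $\lambda_2(G_n)\ge c$ for all $n$. *)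

theory Defs
  imports "HOL-Analysis.Analysis"
begin

section \<open>Finite graphs and the spectral gap\<close>

text \<open>
  An undirected graph is a vertex set \<open>V\<close> together with a set \<open>E\<close> of unordered pairs of
  vertices, an unordered pair being the set \<open>{u, v}\<close>. A loop at \<open>u\<close> is the singleton \<open>{u}\<close>.
\<close>

definition finite_graph :: "'v set \<Rightarrow> 'v set set \<Rightarrow> bool" where
  "finite_graph V E \<longleftrightarrow> finite V \<and> E \<subseteq> {{u, v} | u v. u \<in> V \<and> v \<in> V}"

definition degree :: "'v set set \<Rightarrow> 'v \<Rightarrow> nat" where
  "degree E v = card {e \<in> E. v \<in> e}"

text \<open>
  The summand \<open>|f(u) - f(v)|\<^sup>2\<close> does not depend on the order in which the end points of the
  edge \<open>{u, v}\<close> are listed; see \<open>edge_energy_pair\<close> below.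
\<close>

definition edge_energy :: "('v \<Rightarrow> complex) \<Rightarrow> 'v set \<Rightarrow> real" where
  "edge_energy f e = (THE r. \<exists>u v. e = {u, v} \<and> r = (cmod (f u - f v))\<^sup>2)"

lemma edge_energy_pair: "edge_energy f {u, v} = (cmod (f u - f v))\<^sup>2"
  unfolding edge_energy_def
  by (rule the_equality) (auto simp: doubleton_eq_iff norm_minus_commute)

definition rayleigh_quotient :: "'v set \<Rightarrow> 'v set set \<Rightarrow> ('v \<Rightarrow> complex) \<Rightarrow> real" where
  "rayleigh_quotient V E f = (\<Sum>e\<in>E. edge_energy f e) / (\<Sum>u\<in>V. (cmod (f u))\<^sup>2)"

text \<open>
  Functions on \<open>V\<close> are total functions whose values outside \<open>V\<close> are irrelevant. On a finite
  graph with at least two vertices the infimum is a minimum; see \<open>lambda2_attained\<close> below.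
\<close>

definition lambda2 :: "'v set \<Rightarrow> 'v set set \<Rightarrow> real" where
  "lambda2 V E = Inf {rayleigh_quotient V E f | f. (\<exists>u\<in>V. f u \<noteq> 0) \<and> (\<Sum>u\<in>V. f u) = 0}"

lemma edge_energy_nonneg:
  assumes "finite_graph V E" "e \<in> E"
  shows "edge_energy f e \<ge> 0"
  using assms unfolding finite_graph_def by (auto simp: edge_energy_pair)

lemma lambda2_attained:
  fixes V :: "'v set"
  assumes G: "finite_graph V E" and V2: "card V \<ge> 2"
  shows "\<exists>f. (\<exists>u\<in>V. f u \<noteq> 0) \<and> (\<Sum>u\<in>V. f u) = 0 \<and> lambda2 V E = rayleigh_quotient V E f"
    and "\<And>f. (\<exists>u\<in>V. f u \<noteq> 0) \<Longrightarrow> (\<Sum>u\<in>V. f u) = 0 \<Longrightarrow> lambda2 V E \<le> rayleigh_quotient V E f"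
proof -
  have finV: "finite V" using G by (simp add: finite_graph_def)
  define N :: "('v \<Rightarrow> complex) \<Rightarrow> real" where "N f = (\<Sum>u\<in>V. (cmod (f u))\<^sup>2)" for f
  define Q :: "('v \<Rightarrow> complex) \<Rightarrow> real" where "Q f = (\<Sum>e\<in>E. edge_energy f e)" for f
  define adm :: "('v \<Rightarrow> complex) \<Rightarrow> bool"
    where "adm f \<longleftrightarrow> (\<exists>u\<in>V. f u \<noteq> 0) \<and> (\<Sum>u\<in>V. f u) = 0" for f
  define B where "B = PiE UNIV (\<lambda>u. if u \<in> V then cball (0::complex) 1 else {0})"
  define K where "K = B \<inter> {f. N f = 1} \<inter> {f. (\<Sum>u\<in>V. f u) = 0}"
  have RQ: "rayleigh_quotient V E f = Q f / N f" for f
    by (simp add: rayleigh_quotient_def Q_def N_def)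
  have contE: "continuous_on UNIV (\<lambda>f. edge_energy f e)" if "e \<in> E" for e
  proof -
    obtain u v where "e = {u, v}" using G \<open>e \<in> E\<close> by (auto simp: finite_graph_def)
    then show ?thesis by (simp add: edge_energy_pair) (intro continuous_intros continuous_on_product_coordinates)
  qed
  have contQ: "continuous_on UNIV Q" unfolding Q_def by (intro continuous_on_sum contE)
  have contN: "continuous_on UNIV N" unfolding N_def
    by (intro continuous_intros continuous_on_product_coordinates)
  have contS: "continuous_on UNIV (\<lambda>f :: 'v \<Rightarrow> complex. \<Sum>u\<in>V. f u)"
    by (intro continuous_intros continuous_on_product_coordinates)
  have "compactin (product_topology (\<lambda>u::'v. euclidean :: complex topology) UNIV) B"
    unfolding B_def by (auto simp: compactin_PiE)
  then have "compact B" by (simp add: euclidean_product_topology)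
  moreover have "closed {f. N f = 1}"
    using closed_Collect_eq[OF contN continuous_on_const] .
  moreover have "closed {f :: 'v \<Rightarrow> complex. (\<Sum>u\<in>V. f u) = 0}"
    using closed_Collect_eq[OF contS continuous_on_const] .
  ultimately have "compact K" unfolding K_def by (intro compact_Int_closed)
  have normal: "\<exists>g\<in>K. Q g / N g = Q f / N f" if adm: "adm f" for f
  proof -
    obtain u where u: "u \<in> V" "f u \<noteq> 0" using \<open>adm f\<close> by (auto simp: adm_def)
    have pos: "N f > 0" unfolding N_def
      by (rule sum_pos2[OF finV u(1)]) (use u in auto)
    define s where "s = 1 / sqrt (N f)"
    have s2: "s\<^sup>2 = 1 / N f" using pos by (simp add: s_def power_divide)
    define g where "g u = (if u \<in> V then of_real s * f u else 0)" for u
    have Ng: "N g = 1"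
    proof -
      have "N g = (\<Sum>u\<in>V. s\<^sup>2 * (cmod (f u))\<^sup>2)"
        unfolding N_def g_def by (intro sum.cong) (auto simp: norm_mult power_mult_distrib)
      also have "\<dots> = s\<^sup>2 * N f" by (simp add: N_def sum_distrib_left)
      finally show ?thesis using pos by (simp add: s2)
    qed
    have "Q g = (\<Sum>e\<in>E. s\<^sup>2 * edge_energy f e)"
      unfolding Q_def
    proof (rule sum.cong)
      fix e assume "e \<in> E"
      then obtain u v where uv: "e = {u, v}" "u \<in> V" "v \<in> V"
        using G by (auto simp: finite_graph_def)
      have "cmod (g u - g v) = \<bar>s\<bar> * cmod (f u - f v)"
        using uv by (simp add: g_def norm_mult flip: right_diff_distrib)
      then show "edge_energy g e = s\<^sup>2 * edge_energy f e"
        by (simp add: uv edge_energy_pair power_mult_distrib)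
    qed simp
    also have "\<dots> = s\<^sup>2 * Q f" by (simp add: Q_def sum_distrib_left)
    finally have Qg: "Q g = Q f / N f" by (simp add: s2)
    have "(\<Sum>u\<in>V. g u) = (\<Sum>u\<in>V. of_real s * f u)"
      by (intro sum.cong) (auto simp: g_def)
    also have "\<dots> = 0" using \<open>adm f\<close> by (simp add: adm_def flip: sum_distrib_left)
    finally have Sg: "(\<Sum>u\<in>V. g u) = 0" .
    have "cmod (g v) \<le> 1" if "v \<in> V" for v
    proof -
      have "(cmod (g v))\<^sup>2 \<le> N g"
        unfolding N_def by (rule member_le_sum[OF that _ finV]) simp
      then show ?thesis using Ng by (simp add: power_le_one_iff abs_square_le_1)
    qed
    then have "g \<in> B" by (auto simp: B_def g_def)
    then show ?thesis using Ng Sg Qg by (auto simp: K_def)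
  qed
  have K_adm: "adm g" if "g \<in> K" for g
  proof -
    have "N g \<noteq> 0" using that by (simp add: K_def)
    then have "\<exists>u\<in>V. g u \<noteq> 0" unfolding N_def by (metis (mono_tags, lifting) norm_zero sum.neutral zero_power2)
    then show ?thesis using that by (simp add: adm_def K_def)
  qed
  obtain u where u: "u \<in> V" using V2 by (cases "V = {}") auto
  moreover obtain v where v: "v \<in> V" "v \<noteq> u"
  proof -
    have "\<not> V \<subseteq> {u}" using V2 card_mono[of "{u}" V] by auto
    then show ?thesis using that by auto
  qed
  ultimately have "adm (\<lambda>w. if w = u then 1 else if w = v then - 1 else 0)"
    using finV by (auto simp: adm_def sum.If_cases Int_absorb1 Int_def Collect_conv_if cong: conj_cong)
  then have "K \<noteq> {}" using normal by blast
  obtain g where g: "g \<in> K" "\<And>h. h \<in> K \<Longrightarrow> Q g \<le> Q h"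
    using continuous_attains_inf[OF \<open>compact K\<close> \<open>K \<noteq> {}\<close> continuous_on_subset[OF contQ]] by auto
  have N1: "N h = 1" if "h \<in> K" for h using that by (simp add: K_def)
  have least: "Q g / N g \<le> Q f / N f" if adm: "adm f" for f
  proof -
    obtain h where h: "h \<in> K" "Q h / N h = Q f / N f" using normal[OF adm] by blast
    have "Q g / N g \<le> Q h / N h" using g(2)[OF h(1)] N1[OF g(1)] N1[OF h(1)] by simp
    then show ?thesis using h(2) by simp
  qed
  have eq: "lambda2 V E = Q g / N g"
    unfolding lambda2_def RQ adm_def[symmetric]
    by (rule cInf_eq_minimum) (use K_adm[OF g(1)] least in auto)
  show "\<exists>f. (\<exists>u\<in>V. f u \<noteq> 0) \<and> (\<Sum>u\<in>V. f u) = 0 \<and> lambda2 V E = rayleigh_quotient V E f"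
    using K_adm[OF g(1)] eq by (auto simp: RQ adm_def)
  show "lambda2 V E \<le> rayleigh_quotient V E f"
    if "\<exists>u\<in>V. f u \<noteq> 0" "(\<Sum>u\<in>V. f u) = 0" for f
    using least[of f] that by (simp add: eq RQ adm_def)
qed

definition expander_family :: "'i set \<Rightarrow> ('i \<Rightarrow> 'v set) \<Rightarrow> ('i \<Rightarrow> 'v set set) \<Rightarrow> bool" where
  "expander_family I V E \<longleftrightarrow>
     infinite ((\<lambda>i. (V i, E i)) ` I) \<and>
     (\<forall>i\<in>I. finite_graph (V i) (E i)) \<and>
     (\<exists>D. \<forall>i\<in>I. \<forall>v\<in>V i. degree (E i) v \<le> D) \<and>
     (\<exists>c>0. \<forall>i\<in>I. lambda2 (V i) (E i) \<ge> c)"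

section \<open>The graphs \<open>G\<^sub>n\<close> for a pair of matrices\<close>

text \<open>
  \<open>\<int>/n\<int>\<close> is represented by the residues \<open>0, \<dots>, n - 1\<close>, so that vertices are reduced integer
  vectors; \<open>GL\<^sub>2(\<int>)\<close> is the set of all \<open>S :: int^2^2\<close> with \<open>invertible S\<close>.
\<close>

definition torus :: "nat \<Rightarrow> (int^2) set" where
  "torus n = {v. \<forall>i. v $ i \<in> {0..<int n}}"

definition reduce :: "nat \<Rightarrow> int^2 \<Rightarrow> int^2" where
  "reduce n v = (\<chi> i. v $ i mod int n)"

definition neighbours :: "nat \<Rightarrow> int^2^2 \<Rightarrow> int^2^2 \<Rightarrow> int^2 \<Rightarrow> (int^2) set" where
  "neighbours n S T v =
     reduce n ` {v + vector [1, 0], v - vector [1, 0], v + vector [0, 1], v - vector [0, 1],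
                 S *v v, matrix_inv S *v v, T *v v, matrix_inv T *v v}"

definition torus_edges :: "nat \<Rightarrow> int^2^2 \<Rightarrow> int^2^2 \<Rightarrow> (int^2) set set" where
  "torus_edges n S T = {{v, w} | v w. v \<in> torus n \<and> w \<in> neighbours n S T v}"

end

theory Submission
  imports Defs
begin

text \<open>
  Write \<open>T\<close> for the transpose of \<open>S\<close>. The Fourier transform turns a function on \<open>(\<int>/n)\<^sup>2\<close> with small
  energy into a function \<open>F\<close> on the dual torus that is almost invariant under \<open>S\<close> and \<open>T\<close> and, by the
  translation edges, concentrated near the origin, with \<open>F 0 = 0\<close>. For a symmetric matrix \<open>h\<close> the bounded
  function \<open>\<phi>(x) = \<langle>x, hx\<rangle> / |x|\<^sup>2\<close> satisfies
  \<open>\<phi>(hx) - \<phi>(x) = tr(h) q\<^sub>h(x)\<^sup>2 / (|x|\<^sup>2 |hx|\<^sup>2)\<close>, where \<open>q\<^sub>h(x) = det(x, hx)\<close>, so the measure \<open>|F|\<^sup>2\<close>,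
  being almost invariant under \<open>h = ST\<close> and \<open>h' = TS\<close>, almost annihilates \<open>q\<^sub>h\<^sup>2 / |x|\<^sup>4\<close> and
  \<open>q\<^sub>h\<^sub>'\<^sup>2 / |x|\<^sup>4\<close>. The two forms have no common zero, because the determinant of their coefficients is
  \<open>(a + d)(b - c)((a - d)\<^sup>2 + (b + c)\<^sup>2) \<noteq> 0\<close>; this contradiction is the spectral gap.

  If \<open>b = c\<close> or \<open>a + d = 0\<close>, then \<open>S\<close> and \<open>T\<close> generate a virtually cyclic group, and sums of characters
  over long pieces of one of its orbits are almost invariant under all moves.
\<close>

section \<open>The discrete torus\<close>

lemma reduce_component [simp]: "reduce n v $ i = v $ i mod int n"
  by (simp add: reduce_def)

lemma reduce_reduce [simp]: "reduce n (reduce n v) = reduce n v"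
  by (simp add: reduce_def)

lemma reduce_in_torus: "n > 0 \<Longrightarrow> reduce n v \<in> torus n"
  by (simp add: torus_def)

lemma reduce_torus: "v \<in> torus n \<Longrightarrow> reduce n v = v"
  by (simp add: torus_def vec_eq_iff)

lemma reduce_eq_iff: "reduce n v = reduce n w \<longleftrightarrow> (\<forall>i. int n dvd v $ i - w $ i)"
  by (simp add: vec_eq_iff mod_eq_dvd_iff)

lemma reduce_matrix_vector_mult: "reduce n (A *v reduce n v) = reduce n (A *v v)"
proof -
  have "int n dvd (\<Sum>j\<in>UNIV. A $ i $ j * (v $ j mod int n)) - (\<Sum>j\<in>UNIV. A $ i $ j * v $ j)" for i
  proof -
    have "int n dvd A $ i $ j * (v $ j mod int n) - A $ i $ j * v $ j" for j
      by (metis dvd_mult mod_eq_dvd_iff mod_mod_trivial right_diff_distrib)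
    then show ?thesis
      unfolding sum_subtractf [symmetric] by (intro dvd_sum) auto
  qed
  then show ?thesis
    by (simp add: reduce_eq_iff matrix_vector_mult_def)
qed

lemma reduce_add: "reduce n (reduce n v + w) = reduce n (v + w)"
  by (simp add: vec_eq_iff mod_simps)

lemma bij_betw_torus:
  "bij_betw (\<lambda>v. (v $ 1, v $ 2)) (torus n) ({0..<int n} \<times> {0..<int n})"
  by (rule bij_betw_byWitness[where f' = "\<lambda>(x, y). vector [x, y]"])
     (auto simp: torus_def vec_eq_iff forall_2)

lemma finite_torus [simp]: "finite (torus n)"
  using bij_betw_finite[OF bij_betw_torus] by auto

lemma card_torus: "card (torus n) = n\<^sup>2"
  using bij_betw_same_card[OF bij_betw_torus, of n] by (simp add: power2_eq_square)

lemma sum_torus: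
  "(\<Sum>v\<in>torus n. g (v $ 1) (v $ 2)) = (\<Sum>x\<in>{0..<int n}. \<Sum>y\<in>{0..<int n}. g x y)"
  using sum.reindex_bij_betw[OF bij_betw_torus, of "\<lambda>(x, y). g x y" n]
  by (simp add: sum.cartesian_product)

lemma bij_betw_torus_matrix:
  fixes A B :: "int^2^2"
  assumes "n > 0" and AB: "A ** B = mat 1" "B ** A = mat 1"
  shows "bij_betw (\<lambda>v. reduce n (A *v v)) (torus n) (torus n)"
  using assms
  by (intro bij_betw_byWitness[where f' = "\<lambda>v. reduce n (B *v v)"])
     (auto simp: reduce_matrix_vector_mult matrix_vector_mul_assoc reduce_torus reduce_in_torus)

lemma bij_betw_torus_translation:
  assumes "n > 0"
  shows "bij_betw (\<lambda>v. reduce n (v + w)) (torus n) (torus n)"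
  using assms
  by (intro bij_betw_byWitness[where f' = "\<lambda>v. reduce n (v - w)"])
     (auto simp: reduce_add[where w = "- w", simplified] reduce_add reduce_torus reduce_in_torus)

lemma matrix_inv_mult:
  fixes S :: "int^2^2"
  assumes "invertible S"
  shows "S ** matrix_inv S = mat 1" "matrix_inv S ** S = mat 1"
  using someI_ex[of "\<lambda>B. S ** B = mat 1 \<and> B ** S = mat 1"] assms
  by (auto simp: matrix_inv_def invertible_def)

section \<open>Characters\<close>

text \<open>The argument is an integer rather than a residue, so that characters can be added and
  conjugated without reductions; for positive \<open>n\<close>, \<open>char_mod_cong\<close> gives
  the dependence on the residue alone.\<close>

definition char_mod :: "nat \<Rightarrow> int \<Rightarrow> complex" where
  "char_mod n z = cis (2 * pi * of_int z / of_nat n)"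

lemma char_mod_0 [simp]: "char_mod n 0 = 1"
  by (simp add: char_mod_def)

lemma norm_char_mod [simp]: "cmod (char_mod n z) = 1"
  by (simp add: char_mod_def)

lemma char_mod_add: "char_mod n (z + w) = char_mod n z * char_mod n w"
  by (simp add: char_mod_def cis_mult ring_distribs add_divide_distrib)

lemma char_mod_minus: "char_mod n (- z) = cnj (char_mod n z)"
  by (simp add: char_mod_def cis_cnj)

lemma char_mod_diff: "char_mod n (z - w) = char_mod n z * cnj (char_mod n w)"
  using char_mod_add[of n z "- w"] by (simp add: char_mod_minus)

lemma char_mod_eq_1_iff:
  assumes "n > 0"
  shows "char_mod n z = 1 \<longleftrightarrow> int n dvd z"
proof -
  have "char_mod n z = 1 \<longleftrightarrow> (\<exists>m::int. 2 * pi * of_int z / of_nat n = 2 * pi * of_int m)"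
  proof
    assume "char_mod n z = 1"
    then have "cos (2 * pi * of_int z / of_nat n) = 1"
      by (simp add: char_mod_def complex_eq_iff)
    then show "\<exists>m::int. 2 * pi * of_int z / of_nat n = 2 * pi * of_int m"
      by (simp add: cos_one_2pi_int mult_ac)
  next
    assume "\<exists>m::int. 2 * pi * of_int z / of_nat n = 2 * pi * of_int m"
    then show "char_mod n z = 1"
      by (metis Ints_of_int cis_multiple_2pi char_mod_def)
  qed
  also have "\<dots> \<longleftrightarrow> (\<exists>m::int. real_of_int z = real_of_int (int n * m))"
    using assms by (simp add: field_simps)
  also have "\<dots> \<longleftrightarrow> int n dvd z"
    by (simp only: of_int_eq_iff dvd_def)
  finally show ?thesis .
qed

lemma char_mod_cong:
  assumes "n > 0" "int n dvd z - w"
  shows "char_mod n z = char_mod n w"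
  using assms char_mod_add[of n "z - w" w] char_mod_eq_1_iff[of n "z - w"] by simp

lemma char_mod_mult_of_nat: "char_mod n (z * int m) = char_mod n z ^ m"
  by (induction m) (auto simp: ring_distribs char_mod_add mult.commute)

text \<open>This is a geometric series whose ratio is an \<open>n\<close>-th root of unity.\<close>

lemma sum_char_mod:
  assumes "n > 0"
  shows "(\<Sum>x\<in>{0..<int n}. char_mod n (z * x)) = (if int n dvd z then of_nat n else 0)"
proof -
  have "(\<Sum>x\<in>{0..<int n}. char_mod n (z * x)) = (\<Sum>m<n. char_mod n z ^ m)"
    by (rule sum.reindex_bij_witness[where i = int and j = nat])
       (auto simp flip: char_mod_mult_of_nat)
  also have "\<dots> = (if int n dvd z then of_nat n else 0)"
  proof (cases "int n dvd z")
    case True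
    then have "char_mod n z = 1"
      using assms by (simp add: char_mod_eq_1_iff)
    then show ?thesis
      using True by simp
  next
    case False
    have "char_mod n z ^ n = 1"
      using assms by (simp add: char_mod_eq_1_iff flip: char_mod_mult_of_nat)
    then show ?thesis
      using False assms by (simp add: char_mod_eq_1_iff geometric_sum)
  qed
  finally show ?thesis .
qed

definition dot :: "int^2 \<Rightarrow> int^2 \<Rightarrow> int" where
  "dot k x = k $ 1 * x $ 1 + k $ 2 * x $ 2"

lemma dot_add_right: "dot k (x + y) = dot k x + dot k y"
  by (simp add: dot_def algebra_simps)

lemma dot_diff_left: "dot (k - l) x = dot k x - dot l x"
  by (simp add: dot_def algebra_simps)

lemma dot_diff_right: "dot k (x - y) = dot k x - dot k y"
  by (simp add: dot_def algebra_simps)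

lemma dot_minus_left: "dot (- k) x = - dot k x"
  by (simp add: dot_def)

lemma dot_commute: "dot k x = dot x k"
  by (simp add: dot_def mult.commute)

text \<open>This adjunction exchanges \<open>S\<close> and its transpose: moving a point by one of
  them acts on frequencies by the other.\<close>

lemma dot_matrix: "dot k (A *v x) = dot (transpose A *v k) x"
  by (simp add: dot_def matrix_vector_mult_def transpose_def sum_2 algebra_simps)

lemma char_mod_dot_reduce:
  assumes "n > 0"
  shows "char_mod n (dot k (reduce n x)) = char_mod n (dot k x)"
proof (rule char_mod_cong[OF assms])
  have "dot k (reduce n x) - dot k x = dot k (reduce n x - x)"
    by (simp add: dot_def algebra_simps)
  moreover have "int n dvd x $ i mod int n - x $ i" for i
    by (simp add: mod_eq_dvd_iff flip: mod_eq_dvd_iff)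
  ultimately show "int n dvd dot k (reduce n x) - dot k x"
    by (simp add: dot_def)
qed

lemma char_mod_dot_reduce_left:
  assumes "n > 0"
  shows "char_mod n (dot (reduce n k) x) = char_mod n (dot k x)"
  using char_mod_dot_reduce[OF assms, of x k] by (simp add: dot_commute)

lemma sum_char_mod_dot:
  assumes "n > 0"
  shows "(\<Sum>x\<in>torus n. char_mod n (dot k x)) = (if reduce n k = 0 then of_nat (n\<^sup>2) else 0)"
proof -
  have "(\<Sum>x\<in>torus n. char_mod n (dot k x))
      = (\<Sum>x\<in>{0..<int n}. char_mod n (k $ 1 * x)) * (\<Sum>y\<in>{0..<int n}. char_mod n (k $ 2 * y))"
    unfolding dot_def
    by (subst sum_torus[where g = "\<lambda>x y. char_mod n (k $ 1 * x + k $ 2 * y)"])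
      (simp add: char_mod_add sum_product)
  then show ?thesis
    using assms by (simp add: sum_char_mod vec_eq_iff forall_2 dvd_eq_mod_eq_0 power2_eq_square)
qed

section \<open>Edges and generators\<close>

text \<open>Generators are kept as maps, so that each of them permutes the vertices and sums along
  it can be reindexed. Generators that coincide as maps, such as \<open>S\<close> and
  \<open>T\<close> for symmetric \<open>S\<close>, are counted once.\<close>

definition moves :: "int^2^2 \<Rightarrow> int^2^2 \<Rightarrow> (int^2 \<Rightarrow> int^2) set" where
  "moves S T = {\<lambda>v. v + vector [1, 0], \<lambda>v. v - vector [1, 0], \<lambda>v. v + vector [0, 1],
     \<lambda>v. v - vector [0, 1], (*v) S, (*v) (matrix_inv S), (*v) T, (*v) (matrix_inv T)}"

lemma finite_moves [simp]: "finite (moves S T)"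
  by (simp add: moves_def)

lemma card_moves: "card (moves S T) \<le> 8"
proof -
  have "card (moves S T) \<le> Suc (Suc (Suc (Suc (Suc (Suc (Suc (Suc 0)))))))"
    unfolding moves_def by (intro card_insert_le_m1 | simp)+
  then show ?thesis by simp
qed

lemma torus_edges_moves:
  "torus_edges n S T = (\<lambda>(v, s). {v, reduce n (s v)}) ` (torus n \<times> moves S T)"
  by (auto simp: torus_edges_def neighbours_def moves_def)

lemma bij_betw_move:
  assumes "n > 0" "invertible S" "invertible T" "s \<in> moves S T"
  shows "bij_betw (\<lambda>v. reduce n (s v)) (torus n) (torus n)"
proof -
  note T = bij_betw_torus_translation[OF assms(1)]
  have "bij_betw (\<lambda>v. reduce n (v - w)) (torus n) (torus n)" for w
    using T[of "- w"] by simp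
  then show ?thesis
    using assms(4) T bij_betw_torus_matrix[OF assms(1)] matrix_inv_mult[OF assms(2)]
      matrix_inv_mult[OF assms(3)]
    unfolding moves_def by auto
qed

lemma finite_torus_edges [simp]: "finite (torus_edges n S T)"
  by (simp add: torus_edges_moves)

lemma finite_graph_torus:
  assumes "n > 0"
  shows "finite_graph (torus n) (torus_edges n S T)"
  using reduce_in_torus[OF assms] by (fastforce simp: finite_graph_def torus_edges_moves)

text \<open>An edge through \<open>v\<close> comes from a move leaving \<open>v\<close> or from a
  move arriving at \<open>v\<close>. As moves are bijections, an arriving move has a single source,
  which leaves at most 8 + 8 edges.\<close>

lemma degree_torus_le:
  assumes "n > 0" "invertible S" "invertible T" "v \<in> torus n"
  shows "degree (torus_edges n S T) v \<le> 16"
proof -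
  define r where "r s = inv_into (torus n) (\<lambda>v. reduce n (s v))" for s
  define A where "A = (\<lambda>s. {v, reduce n (s v)}) ` moves S T"
  define B where "B = (\<lambda>s. {r s v, v}) ` moves S T"
  have "e \<in> A \<union> B" if e: "e \<in> torus_edges n S T" "v \<in> e" for e
  proof -
    obtain u s where u: "u \<in> torus n" "s \<in> moves S T" "e = {u, reduce n (s u)}"
      using e(1) by (auto simp: torus_edges_moves)
    have "r s (reduce n (s u)) = u"
      using bij_betw_move[OF assms(1-3) u(2)] u(1)
      unfolding r_def bij_betw_def
      using inv_into_f_f[of "\<lambda>v. reduce n (s v)" "torus n" u] by simp
    then have "e = {r s (reduce n (s u)), reduce n (s u)}"
      using u(3) by simp
    moreover have "v = u \<or> v = reduce n (s u)"
      using u(3) e(2) by auto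
    moreover have "{w, reduce n (s w)} \<in> A" "{r s w, w} \<in> B" if "v = w" for w
      unfolding A_def B_def that using u(2) by (rule imageI)+
    ultimately show ?thesis
      using u(3) by auto
  qed
  then have "degree (torus_edges n S T) v \<le> card (A \<union> B)"
    unfolding degree_def by (intro card_mono) (auto simp: A_def B_def)
  also have "\<dots> \<le> card A + card B"
    by (rule card_Un_le)
  also have "\<dots> \<le> 8 + 8"
    unfolding A_def B_def by (intro add_mono order_trans[OF card_image_le card_moves]) simp_all
  finally show ?thesis by simp
qed

text \<open>The graphs are pairwise distinct because their vertex sets have \<open>n^2\<close>
  elements, and the degrees are at most 16. Only the uniform gap depends on the matrices.\<close>

lemma expander_family_torus_iff:
  assumes "invertible S" "invertible T"
  shows "expander_family {2..} torus (\<lambda>n. torus_edges n S T)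
    \<longleftrightarrow> (\<exists>c>0. \<forall>n\<ge>2. lambda2 (torus n) (torus_edges n S T) \<ge> c)"
proof -
  have "inj_on (\<lambda>n. (torus n, torus_edges n S T)) {2..}"
    by (rule inj_onI) (metis card_torus power2_eq_iff_nonneg prod.inject zero_le)
  then have "infinite ((\<lambda>n. (torus n, torus_edges n S T)) ` {2..})"
    using finite_imageD infinite_Ici by blast
  moreover have "\<forall>n\<in>{2..}. finite_graph (torus n) (torus_edges n S T)"
    using finite_graph_torus by simp
  moreover have "\<exists>D. \<forall>n\<in>{2..}. \<forall>v\<in>torus n. degree (torus_edges n S T) v \<le> D"
    using degree_torus_le[OF _ assms] by (intro exI[of _ 16]) simp
  ultimately show ?thesis
    by (simp add: expander_family_def Ball_def)
qed

text \<open>Every edge arises from at least one pair of a vertex and a move, and all terms are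
  nonnegative.\<close>

lemma sum_edge_energy_le:
  assumes "n > 0"
  shows "(\<Sum>e\<in>torus_edges n S T. edge_energy f e)
    \<le> (\<Sum>v\<in>torus n. \<Sum>s\<in>moves S T. (cmod (f v - f (reduce n (s v))))\<^sup>2)"
proof -
  have "sum (edge_energy f) (torus_edges n S T)
      \<le> sum (edge_energy f \<circ> (\<lambda>(v, s). {v, reduce n (s v)})) (torus n \<times> moves S T)"
    unfolding torus_edges_moves by (rule sum_image_le) (auto simp: edge_energy_pair)
  then show ?thesis
    by (simp add: sum.cartesian_product edge_energy_pair case_prod_unfold)
qed

text \<open>The factor 2 bounds the fibres of \<open>v\<close> \<mapsto>
  \<open>{v, reduce n (s v)}\<close>: the source of an edge is one of its two end points.\<close>

lemma sum_move_le:
  assumes "n > 0" "s \<in> moves S T"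
  shows "(\<Sum>v\<in>torus n. (cmod (f v - f (reduce n (s v))))\<^sup>2)
    \<le> 2 * (\<Sum>e\<in>torus_edges n S T. edge_energy f e)"
proof -
  define h where "h v = {v, reduce n (s v)}" for v
  have sub: "h ` torus n \<subseteq> torus_edges n S T"
    using assms(2) by (auto simp: h_def torus_edges_moves)
  have nonneg: "0 \<le> edge_energy f e" if "e \<in> torus_edges n S T" for e
    using edge_energy_nonneg[OF finite_graph_torus[OF assms(1)] that] .
  have "(\<Sum>v\<in>torus n. (cmod (f v - f (reduce n (s v))))\<^sup>2) = (\<Sum>v\<in>torus n. edge_energy f (h v))"
    by (simp add: h_def edge_energy_pair)
  also have "\<dots> = (\<Sum>e\<in>h ` torus n. \<Sum>v | v \<in> torus n \<and> h v = e. edge_energy f (h v))"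
    by (rule sum.image_gen) simp
  also have "\<dots> = (\<Sum>e\<in>h ` torus n. card {v. v \<in> torus n \<and> h v = e} * edge_energy f e)"
    by simp
  also have "\<dots> \<le> (\<Sum>e\<in>h ` torus n. 2 * edge_energy f e)"
  proof (intro sum_mono mult_right_mono)
    fix e assume e: "e \<in> h ` torus n"
    then obtain u where "e = h u" by blast
    then have "card {v. v \<in> torus n \<and> h v = e} \<le> card {u, reduce n (s u)}"
      by (intro card_mono) (auto simp: h_def)
    also have "\<dots> \<le> 2"
      by (simp add: card_insert_if)
    finally show "real (card {v. v \<in> torus n \<and> h v = e}) \<le> 2" by simp
    show "0 \<le> edge_energy f e"
      using e sub nonneg by blast
  qed
  also have "\<dots> \<le> (\<Sum>e\<in>torus_edges n S T. 2 * edge_energy f e)"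
    using sub nonneg by (intro sum_mono2) auto
  finally show ?thesis
    by (simp add: sum_distrib_left)
qed

section \<open>Amenable orbits obstruct expansion\<close>

text \<open>These are the test functions against expansion. Frequencies are indexed rather than
  collected in a set, so that an orbit that closes up counts with multiplicity.\<close>

definition character_sum :: "nat \<Rightarrow> 'i set \<Rightarrow> ('i \<Rightarrow> int^2) \<Rightarrow> int^2 \<Rightarrow> complex" where
  "character_sum n I p x = (\<Sum>i\<in>I. char_mod n (dot (p i) x))"

lemma character_sum_reduce [simp]:
  "n > 0 \<Longrightarrow> character_sum n I p (reduce n x) = character_sum n I p x"
  by (simp add: character_sum_def char_mod_dot_reduce)

lemma sum_character_sum_eq_0:
  assumes "n > 0" "\<And>i. i \<in> I \<Longrightarrow> reduce n (p i) \<noteq> 0"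
  shows "(\<Sum>x\<in>torus n. character_sum n I p x) = 0"
  unfolding character_sum_def
  by (subst sum.swap) (use assms in \<open>simp add: sum_char_mod_dot\<close>)

text \<open>After expanding the square, orthogonality makes every pair of indices contribute 0 or
  \<open>n^2\<close>. The diagonal alone gives the bound, and coinciding frequencies can only
  increase the sum.\<close>

lemma norm_character_sum_ge:
  assumes "n > 0" "finite I"
  shows "(\<Sum>x\<in>torus n. (cmod (character_sum n I p x))\<^sup>2) \<ge> real (n\<^sup>2) * card I"
proof -
  define \<delta> where "\<delta> i j = (if reduce n (p i - p j) = 0 then real (n\<^sup>2) else 0)" for i j
  have "complex_of_real (\<Sum>x\<in>torus n. (cmod (character_sum n I p x))\<^sup>2)
      = (\<Sum>x\<in>torus n. \<Sum>i\<in>I. \<Sum>j\<in>I. char_mod n (dot (p i - p j) x))"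
    by (simp add: complex_norm_square character_sum_def sum_product dot_diff_left char_mod_diff
        del: of_real_power)
  also have "\<dots> = (\<Sum>i\<in>I. \<Sum>x\<in>torus n. \<Sum>j\<in>I. char_mod n (dot (p i - p j) x))"
    by (rule sum.swap)
  also have "\<dots> = (\<Sum>i\<in>I. \<Sum>j\<in>I. \<Sum>x\<in>torus n. char_mod n (dot (p i - p j) x))"
    by (intro sum.cong refl sum.swap)
  also have "\<dots> = complex_of_real (\<Sum>i\<in>I. \<Sum>j\<in>I. \<delta> i j)"
    unfolding of_real_sum by (intro sum.cong refl) (simp add: sum_char_mod_dot assms(1) \<delta>_def)
  finally have eq: "(\<Sum>x\<in>torus n. (cmod (character_sum n I p x))\<^sup>2) = (\<Sum>i\<in>I. \<Sum>j\<in>I. \<delta> i j)"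
    by (simp only: of_real_eq_iff)
  have "real (n\<^sup>2) * card I = (\<Sum>i\<in>I. \<delta> i i)"
    by (simp add: \<delta>_def vec_eq_iff mult.commute)
  also have "\<dots> \<le> (\<Sum>i\<in>I. \<Sum>j\<in>I. \<delta> i j)"
    using assms(2) by (intro sum_mono member_le_sum) (auto simp: \<delta>_def)
  finally show ?thesis
    unfolding eq .
qed

section \<open>Fixed frequencies and growing modulus\<close>

lemma char_mod_tendsto_1: "(\<lambda>n. char_mod n z) \<longlonglongrightarrow> 1"
proof -
  have "(\<lambda>n. cis (2 * pi * of_int z / of_nat n)) \<longlonglongrightarrow> cis 0"
    by (intro tendsto_cis lim_const_over_n)
  then show ?thesis
    by (simp add: char_mod_def)
qed

text \<open>With the frequencies fixed, each \<open>char_mod n (dot (p i) w)\<close> tends to 1, so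
  the total defect tends to 0. The number 8 is chosen to agree with the bound imposed on the matrix
  moves below.\<close>

lemma eventually_character_sum_translation:
  assumes "finite I"
  shows "eventually (\<lambda>n. \<forall>x. cmod (character_sum n I p (x + w) - character_sum n I p x) \<le> 8) sequentially"
proof -
  have "(\<lambda>n. \<Sum>i\<in>I. cmod (char_mod n (dot (p i) w) - 1)) \<longlonglongrightarrow> (\<Sum>i\<in>I. cmod (1 - 1))"
    by (intro tendsto_intros char_mod_tendsto_1)
  then have "eventually (\<lambda>n. (\<Sum>i\<in>I. cmod (char_mod n (dot (p i) w) - 1)) < 8) sequentially"
    by (rule order_tendstoD) simp
  then show ?thesis
  proof eventually_elim
    fix n assume small: "(\<Sum>i\<in>I. cmod (char_mod n (dot (p i) w) - 1)) < 8"
    have "cmod (character_sum n I p (x + w) - character_sum n I p x) \<le> 8" for x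
    proof -
      have "character_sum n I p (x + w) - character_sum n I p x
          = (\<Sum>i\<in>I. char_mod n (dot (p i) x) * (char_mod n (dot (p i) w) - 1))"
        by (simp add: character_sum_def dot_add_right char_mod_add algebra_simps flip: sum_subtractf)
      also have "cmod \<dots> \<le> (\<Sum>i\<in>I. cmod (char_mod n (dot (p i) w) - 1))"
        by (rule order_trans[OF norm_sum]) (simp add: norm_mult)
      finally show ?thesis
        using small by simp
    qed
    then show "\<forall>x. cmod (character_sum n I p (x + w) - character_sum n I p x) \<le> 8"
      by blast
  qed
qed

lemma eventually_reduce_ne_0:
  assumes "q \<noteq> 0"
  shows "eventually (\<lambda>n. reduce n q \<noteq> 0) sequentially"
proof -
  obtain i where i: "q $ i \<noteq> 0"
    using assms by (auto simp: vec_eq_iff)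
  show ?thesis
    using eventually_gt_at_top[of "nat \<bar>q $ i\<bar>"]
  proof eventually_elim
    case (elim n)
    then have "\<not> int n dvd q $ i"
      using i zdvd_imp_le[of "int n" "\<bar>q $ i\<bar>"] by auto
    then show ?case
      by (auto simp: vec_eq_iff dvd_eq_mod_eq_0)
  qed
qed

text \<open>The frequencies are chosen first and \<open>n\<close> is then taken large, so that they
  stay nonzero modulo \<open>n\<close> and translations hardly matter. Each vertex carries energy at
  most 8 moves times 8^2 = 512, while the average mass per vertex is at least
  \<open>card I\<close>.\<close>

lemma lambda2_small_if_orbit:
  fixes I :: "'i set" and p :: "'i \<Rightarrow> int^2"
  assumes inv: "invertible S" "invertible T" and I: "finite I" "I \<noteq> {}"
    and p: "\<And>i. i \<in> I \<Longrightarrow> p i \<noteq> 0"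
    and S: "\<And>n x. cmod (character_sum n I p (S *v x) - character_sum n I p x) \<le> 8"
    and T: "\<And>n x. cmod (character_sum n I p (T *v x) - character_sum n I p x) \<le> 8"
  shows "\<exists>n\<ge>2. lambda2 (torus n) (torus_edges n S T) \<le> 512 / card I"
proof -
  note transl = eventually_character_sum_translation[OF I(1), of p]
  have "eventually (\<lambda>n. \<forall>i\<in>I. reduce n (p i) \<noteq> 0) sequentially"
    using I(1) p eventually_reduce_ne_0 by (simp add: eventually_ball_finite)
  from eventually_conj[OF this eventually_conj[OF eventually_ge_at_top[of 2]
      eventually_conj[OF transl[of "vector [1, 0]"] transl[of "vector [0, 1]"]]]]
  obtain n where n: "\<And>i. i \<in> I \<Longrightarrow> reduce n (p i) \<noteq> 0" "n \<ge> 2"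
    and tr: "\<And>x. cmod (character_sum n I p (x + vector [1, 0]) - character_sum n I p x) \<le> 8"
      "\<And>x. cmod (character_sum n I p (x + vector [0, 1]) - character_sum n I p x) \<le> 8"
    unfolding eventually_sequentially by blast
  define f where "f = character_sum n I p"
  have inverse_le: "cmod (f (matrix_inv A *v x) - f x) \<le> 8"
    if "invertible A" "\<And>x. cmod (f (A *v x) - f x) \<le> 8" for A x
    using that(2)[of "matrix_inv A *v x"] matrix_inv_mult[OF that(1)]
    by (simp add: matrix_vector_mul_assoc norm_minus_commute)
  have "cmod (f (s x) - f x) \<le> 8" if "s \<in> moves S T" for s x
    using that S[of n] T[of n] tr tr(1)[of "x - vector [1, 0]"] tr(2)[of "x - vector [0, 1]"]
      inverse_le[OF inv(1)] inverse_le[OF inv(2)]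
    unfolding moves_def f_def[symmetric] by (auto simp: norm_minus_commute)
  then have step: "(cmod (f x - f (reduce n (s x))))\<^sup>2 \<le> 8\<^sup>2" if "s \<in> moves S T" for s x
    using that n(2) by (intro power_mono) (auto simp: f_def norm_minus_commute)
  have "(\<Sum>v\<in>torus n. \<Sum>s\<in>moves S T. (cmod (f v - f (reduce n (s v))))\<^sup>2)
      \<le> (\<Sum>v\<in>torus n. \<Sum>s\<in>moves S T. 8\<^sup>2)"
    by (intro sum_mono step)
  also have "\<dots> = real (n\<^sup>2) * (64 * card (moves S T))"
    by (simp add: card_torus)
  also have "\<dots> \<le> real (n\<^sup>2) * 512"
    using card_moves[of S T] by (intro mult_left_mono) simp_all
  finally have energy: "(\<Sum>e\<in>torus_edges n S T. edge_energy f e) \<le> real (n\<^sup>2) * 512"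
    using sum_edge_energy_le[of n f S T] n(2) by linarith
  have mass: "(\<Sum>x\<in>torus n. (cmod (f x))\<^sup>2) \<ge> real (n\<^sup>2) * card I"
    unfolding f_def using n(2) I(1) by (intro norm_character_sum_ge) simp_all
  have pos: "real (n\<^sup>2) * card I > 0"
    using n(2) I by (simp add: card_gt_0_iff)
  have "\<exists>u\<in>torus n. f u \<noteq> 0"
  proof (rule ccontr)
    assume "\<not> (\<exists>u\<in>torus n. f u \<noteq> 0)"
    then have "(\<Sum>x\<in>torus n. (cmod (f x))\<^sup>2) = 0" by simp
    with mass pos show False by simp
  qed
  moreover have "(\<Sum>x\<in>torus n. f x) = 0"
    unfolding f_def using n by (intro sum_character_sum_eq_0) simp_all
  moreover have "card (torus n) \<ge> 2"
    using n(2) self_le_power[of n 2] by (simp add: card_torus)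
  ultimately have "lambda2 (torus n) (torus_edges n S T) \<le> rayleigh_quotient (torus n) (torus_edges n S T) f"
    using n(2) by (intro lambda2_attained(2) finite_graph_torus) simp_all
  also have "\<dots> \<le> (real (n\<^sup>2) * 512) / (real (n\<^sup>2) * card I)"
    unfolding rayleigh_quotient_def using energy mass pos by (intro frac_le) simp_all
  also have "\<dots> = 512 / card I"
    using n(2) by simp
  finally show ?thesis
    using n(2) by blast
qed

lemma not_expander_if_orbits:
  assumes inv: "invertible S" "invertible T"
    and orbits: "\<And>K. \<exists>(I :: 'i set) p. finite I \<and> card I > K \<and> (\<forall>i\<in>I. p i \<noteq> 0)
      \<and> (\<forall>n x. cmod (character_sum n I p (S *v x) - character_sum n I p x) \<le> 8)
      \<and> (\<forall>n x. cmod (character_sum n I p (T *v x) - character_sum n I p x) \<le> 8)"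
  shows "\<not> expander_family {2..} torus (\<lambda>n. torus_edges n S T)"
  unfolding expander_family_torus_iff[OF inv]
proof safe
  fix c :: real
  assume c: "c > 0" "\<forall>n\<ge>2. lambda2 (torus n) (torus_edges n S T) \<ge> c"
  obtain K :: nat where K: "512 / c < K"
    using reals_Archimedean2 by blast
  obtain I :: "'i set" and p where I: "finite I" "card I > K" "\<And>i. i \<in> I \<Longrightarrow> p i \<noteq> 0"
    "\<And>n x. cmod (character_sum n I p (S *v x) - character_sum n I p x) \<le> 8"
    "\<And>n x. cmod (character_sum n I p (T *v x) - character_sum n I p x) \<le> 8"
    using orbits[of K] by blast
  moreover from I(2) have "I \<noteq> {}" by auto
  ultimately have "\<exists>n\<ge>2. lambda2 (torus n) (torus_edges n S T) \<le> 512 / card I"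
    using inv by (intro lambda2_small_if_orbit) auto
  then have "c \<le> 512 / card I"
    using c(2) by force
  have "0 < 512 / c"
    using c(1) by simp
  then have "real K < card I" "0 < real K"
    using I(2) K by linarith+
  then have "512 / card I \<le> 512 / K"
    by (intro divide_left_mono) auto
  moreover have "512 / K < c"
    using K c(1) \<open>0 < real K\<close> by (simp add: field_simps)
  ultimately show False
    using \<open>c \<le> 512 / card I\<close> by linarith
qed

text \<open>The frequencies run through the first \<open>K + 1\<close> points of the orbit of a
  basis vector under \<open>S\<close>. Since \<open>S\<close> is its own adjoint, applying it shifts
  this segment by one, and only the two end terms survive.\<close>

lemma not_expander_symmetric:
  assumes inv: "invertible S" and sym: "transpose S = S"
  shows "\<not> expander_family {2..} torus (\<lambda>n. torus_edges n S S)"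
proof (rule not_expander_if_orbits[OF inv inv])
  fix K :: nat
  define p where "p j = (((*v) S) ^^ j) (vector [1, 0])" for j
  have p_Suc: "S *v p j = p (Suc j)" for j
    by (simp add: p_def)
  have inj: "S *v v \<noteq> 0" if "v \<noteq> 0" for v
    using that matrix_inv_mult[OF inv]
    by (metis matrix_vector_mul_assoc matrix_vector_mul_lid matrix_vector_mult_0_right)
  have "p j \<noteq> 0" for j
    by (induction j) (simp_all add: inj flip: p_Suc, simp add: p_def vec_eq_iff forall_2)
  moreover have "cmod (character_sum n {..K} p (S *v x) - character_sum n {..K} p x) \<le> 8" for n x
  proof -
    have "character_sum n {..K} p (S *v x) - character_sum n {..K} p x
        = (\<Sum>j\<le>K. char_mod n (dot (p (Suc j)) x) - char_mod n (dot (p j) x))"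
      by (simp add: character_sum_def dot_matrix sym p_Suc sum_subtractf)
    also have "\<dots> = char_mod n (dot (p (Suc K)) x) - char_mod n (dot (p 0) x)"
      by (induction K) simp_all
    also have "cmod \<dots> \<le> 1 + 1"
      by (rule order_trans[OF norm_triangle_ineq4]) simp
    finally show ?thesis by simp
  qed
  ultimately show "\<exists>(I :: nat set) p. finite I \<and> card I > K \<and> (\<forall>i\<in>I. p i \<noteq> 0)
      \<and> (\<forall>n x. cmod (character_sum n I p (S *v x) - character_sum n I p x) \<le> 8)
      \<and> (\<forall>n x. cmod (character_sum n I p (S *v x) - character_sum n I p x) \<le> 8)"
    by (intro exI[of _ "{..K}"] exI[of _ p]) simp
qed

text \<open>Up to sign both matrices are involutions, so modulo signs they generate a dihedral
  group, whose orbits are chains on which the two matrices alternately exchange neighbours. A long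
  piece of such a chain changes only at its ends.\<close>

lemma not_expander_involutions:
  fixes S :: "int^2^2" and \<sigma> :: int
  defines "T \<equiv> transpose S"
  assumes inv: "invertible S" "invertible T" and \<sigma>: "\<sigma> = 1 \<or> \<sigma> = - 1"
    and SS: "\<And>v. S *v (S *v v) = \<sigma> *s v" and TT: "\<And>v. T *v (T *v v) = \<sigma> *s v"
  shows "\<not> expander_family {2..} torus (\<lambda>n. torus_edges n S T)"
proof (rule not_expander_if_orbits[OF inv])
  fix K :: nat
  define q where "q j = (((*v) (S ** T)) ^^ j) (vector [1, 0])" for j
  have q_Suc: "S *v (T *v q j) = q (Suc j)" for j
    by (simp add: q_def matrix_vector_mul_assoc)
  have inj: "A *v v \<noteq> 0" if "v \<noteq> 0" "invertible A" for A :: "int^2^2" and v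
    using that matrix_inv_mult[OF that(2)]
    by (metis matrix_vector_mul_assoc matrix_vector_mul_lid matrix_vector_mult_0_right)
  have q_ne: "q j \<noteq> 0" for j
    by (induction j) (simp_all add: inj inv flip: q_Suc, simp add: q_def vec_eq_iff forall_2)
  \<comment> \<open>Both signs of each frequency are included because \<open>S\<close> and
    \<open>T\<close> square to \<sigma>, which may be -1.\<close>
  define p where "p = (\<lambda>(j, l). [q j, - q j, T *v q j, - (T *v q j)] ! l)"
  define I where "I = {..K} \<times> {..<4::nat}"
  have four: "{..<4::nat} = {0, 1, 2, 3}" by auto
  have p_ne: "p i \<noteq> 0" if "i \<in> I" for i
    using that q_ne inj[OF q_ne inv(2)]
    by (auto simp: p_def I_def four)
  \<comment> \<open>\<open>G\<close> is even in the frequency, so the sign \<sigma> disappears in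
    \<open>G_\<sigma>\<close>.\<close>
  define G where "G n v x = char_mod n (dot v x) + char_mod n (- dot v x)" for n v x
  have G_\<sigma>: "G n (\<sigma> *s v) x = G n v x" for n v x
    using \<sigma> by (auto simp: G_def dot_def vector_scalar_mult_def)
  have norm_G: "cmod (G n v x) \<le> 2" for n v x
    using norm_triangle_ineq[of "char_mod n (dot v x)" "char_mod n (- dot v x)"] by (simp add: G_def)
  have sum_eq: "character_sum n I p x = (\<Sum>j\<le>K. G n (q j) x + G n (T *v q j) x)" for n x
  proof -
    have "character_sum n I p x = (\<Sum>j\<le>K. \<Sum>l<4. char_mod n (dot (p (j, l)) x))"
      by (simp add: character_sum_def I_def sum.cartesian_product)
    then show ?thesis
      by (simp add: p_def G_def dot_minus_left four add.assoc)
  qed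
  have G_S: "G n v (S *v x) = G n (T *v v) x" and G_T: "G n v (T *v x) = G n (S *v v) x" for n v x
    by (simp_all add: G_def dot_matrix T_def del: transpose_matrix_vector)
  have "character_sum n I p (S *v x) = character_sum n I p x" for n x
    by (simp add: sum_eq G_S TT G_\<sigma> add.commute)
  moreover have "cmod (character_sum n I p (T *v x) - character_sum n I p x) \<le> 8" for n x
  proof -
    \<comment> \<open>On frequencies, \<open>S\<close> sends \<open>T *v q j\<close> to
      \<open>q (Suc j)\<close> and, up to the sign \<sigma>, back again. Hence the sum below
      telescopes.\<close>
    have S_q: "G n (S *v q (Suc j)) x = G n (T *v q j) x" for j
      by (simp add: SS G_\<sigma> flip: q_Suc)
    have "character_sum n I p (T *v x) - character_sum n I p x
        = (\<Sum>j\<le>K. (G n (S *v q j) x + G n (q (Suc j)) x) - (G n (q j) x + G n (S *v q (Suc j)) x))"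
      by (simp add: sum_eq G_T q_Suc S_q sum_subtractf)
    \<comment> \<open>Four boundary terms of norm at most 2 remain; this is the origin of the bound
      8.\<close>
    also have "\<dots> = (G n (q (Suc K)) x - G n (q 0) x) + (G n (S *v q 0) x - G n (S *v q (Suc K)) x)"
      by (induction K) simp_all
    also have "cmod \<dots> \<le> (2 + 2) + (2 + 2)"
      by (intro norm_triangle_mono norm_triangle_le_diff add_mono norm_G)
    finally show ?thesis by simp
  qed
  moreover have "finite I" "card I > K"
    by (simp_all add: I_def card_cartesian_product)
  ultimately show "\<exists>(I :: (nat \<times> nat) set) p. finite I \<and> card I > K \<and> (\<forall>i\<in>I. p i \<noteq> 0)
      \<and> (\<forall>n x. cmod (character_sum n I p (S *v x) - character_sum n I p x) \<le> 8)
      \<and> (\<forall>n x. cmod (character_sum n I p (T *v x) - character_sum n I p x) \<le> 8)"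
    using p_ne by (intro exI[of _ I] exI[of _ p]) simp
qed

section \<open>Fourier transform on the torus\<close>

text \<open>The transform is unnormalised, which puts the factor \<open>n^2\<close> into Parseval's
  identity. Frequencies are arbitrary integer vectors, with periodicity recorded in
  \<open>fourier_reduce\<close>.\<close>

definition fourier :: "nat \<Rightarrow> (int^2 \<Rightarrow> complex) \<Rightarrow> int^2 \<Rightarrow> complex" where
  "fourier n f k = (\<Sum>x\<in>torus n. f x * cnj (char_mod n (dot k x)))"

lemma fourier_reduce [simp]: "n > 0 \<Longrightarrow> fourier n f (reduce n k) = fourier n f k"
  by (simp add: fourier_def char_mod_dot_reduce_left)

lemma fourier_diff: "fourier n (\<lambda>x. f x - g x) k = fourier n f k - fourier n g k"
  by (simp add: fourier_def left_diff_distrib sum_subtractf)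

lemma fourier_0: "fourier n f 0 = (\<Sum>x\<in>torus n. f x)"
  by (simp add: fourier_def dot_def)

lemma parseval:
  assumes "n > 0"
  shows "(\<Sum>k\<in>torus n. (cmod (fourier n f k))\<^sup>2) = real (n\<^sup>2) * (\<Sum>x\<in>torus n. (cmod (f x))\<^sup>2)"
proof -
  have delta: "(\<Sum>k\<in>torus n. char_mod n (dot k (y - x))) = (if x = y then of_nat (n\<^sup>2) else 0)"
    if "x \<in> torus n" "y \<in> torus n" for x y
  proof -
    have "reduce n (y - x) = 0 \<longleftrightarrow> reduce n x = reduce n y"
      by (auto simp: vec_eq_iff mod_eq_dvd_iff dvd_eq_mod_eq_0[symmetric] dvd_diff_commute)
    then show ?thesis
      using sum_char_mod_dot[OF assms, of "y - x"] that by (simp add: dot_commute[of _ "y - x"] reduce_torus)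
  qed
  have "complex_of_real (\<Sum>k\<in>torus n. (cmod (fourier n f k))\<^sup>2)
      = (\<Sum>k\<in>torus n. \<Sum>x\<in>torus n. \<Sum>y\<in>torus n. f x * cnj (f y) * char_mod n (dot k (y - x)))"
    by (simp add: complex_norm_square fourier_def sum_product dot_diff_right
        char_mod_diff mult_ac del: of_real_power)
  also have "\<dots> = (\<Sum>x\<in>torus n. \<Sum>k\<in>torus n. \<Sum>y\<in>torus n. f x * cnj (f y) * char_mod n (dot k (y - x)))"
    by (rule sum.swap)
  also have "\<dots> = (\<Sum>x\<in>torus n. \<Sum>y\<in>torus n. \<Sum>k\<in>torus n. f x * cnj (f y) * char_mod n (dot k (y - x)))"
    by (intro sum.cong refl sum.swap)
  also have "\<dots> = (\<Sum>x\<in>torus n. f x * cnj (f x) * of_nat (n\<^sup>2))"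
    by (intro sum.cong refl) (simp add: delta if_distrib flip: sum_distrib_left cong: if_cong)
  also have "\<dots> = complex_of_real (real (n\<^sup>2) * (\<Sum>x\<in>torus n. (cmod (f x))\<^sup>2))"
    by (simp only: complex_norm_square sum_distrib_left mult_ac of_real_mult of_real_sum
        of_real_of_nat_eq)
  finally show ?thesis
    by (simp only: of_real_eq_iff)
qed

lemma fourier_translation:
  assumes "n > 0"
  shows "fourier n (\<lambda>x. f (reduce n (x + w))) k = fourier n f k * char_mod n (dot k w)"
proof -
  define g where "g y = f y * cnj (char_mod n (dot k y)) * char_mod n (dot k w)" for y
  have "f (reduce n (x + w)) * cnj (char_mod n (dot k x)) = g (reduce n (x + w))" for x
    using norm_char_mod[of n "dot k w"]
    by (simp add: g_def char_mod_dot_reduce assms dot_add_right char_mod_add mult.assoc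
        complex_norm_square[symmetric] mult.commute[of "cnj (char_mod n (dot k w))"])
  then have "fourier n (\<lambda>x. f (reduce n (x + w))) k = (\<Sum>x\<in>torus n. g (reduce n (x + w)))"
    by (simp add: fourier_def)
  also have "\<dots> = sum g (torus n)"
    by (rule sum.reindex_bij_betw[OF bij_betw_torus_translation[OF assms]])
  finally show ?thesis
    by (simp add: g_def fourier_def sum_distrib_right)
qed

text \<open>Substituting \<open>y\<close> for the image of \<open>x\<close> under \<open>A\<close>
  pairs \<open>k\<close> with \<open>B *v y\<close>, that is, \<open>transpose B *v k\<close> with
  \<open>y\<close>: the dual action is by the inverse transpose.\<close>

lemma fourier_matrix:
  assumes "n > 0" "A ** B = mat 1" "B ** A = mat 1"
  shows "fourier n (\<lambda>x. f (reduce n (A *v x))) k = fourier n f (transpose B *v k)"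
proof -
  define g where "g y = f y * cnj (char_mod n (dot (transpose B *v k) y))" for y
  have "g (reduce n y) = f (reduce n y) * cnj (char_mod n (dot k (B *v y)))" for y
    by (simp only: g_def char_mod_dot_reduce[OF assms(1)] dot_matrix)
  then have "f (reduce n (A *v x)) * cnj (char_mod n (dot k x)) = g (reduce n (A *v x))" for x
    using assms(3) by (simp add: matrix_vector_mul_assoc)
  then have "fourier n (\<lambda>x. f (reduce n (A *v x))) k = (\<Sum>x\<in>torus n. g (reduce n (A *v x)))"
    by (simp add: fourier_def)
  also have "\<dots> = sum g (torus n)"
    by (rule sum.reindex_bij_betw[OF bij_betw_torus_matrix[OF assms]])
  finally show ?thesis
    by (simp add: g_def fourier_def)
qed

text \<open>A translation multiplies the transform by a character. Small energy along the unit
  translations therefore penalises mass of the transform away from the origin.\<close>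

lemma sum_translation_defect:
  assumes "n > 0"
  shows "(\<Sum>k\<in>torus n. (cmod (char_mod n (dot k w) - 1))\<^sup>2 * (cmod (fourier n f k))\<^sup>2)
    = real (n\<^sup>2) * (\<Sum>x\<in>torus n. (cmod (f x - f (reduce n (x + w))))\<^sup>2)"
proof -
  have "(cmod (char_mod n (dot k w) - 1))\<^sup>2 * (cmod (fourier n f k))\<^sup>2
      = (cmod (fourier n (\<lambda>x. f x - f (reduce n (x + w))) k))\<^sup>2" for k
    unfolding fourier_diff fourier_translation[OF assms]
    by (simp add: norm_minus_commute[of _ "_ * _"] power_mult_distrib [symmetric]
        norm_mult [symmetric] algebra_simps)
  then show ?thesis
    using parseval[OF assms, of "\<lambda>x. f x - f (reduce n (x + w))"] by simp
qed

lemma sum_matrix_defect: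
  assumes "n > 0" "A ** B = mat 1" "B ** A = mat 1"
  shows "(\<Sum>k\<in>torus n. (cmod (fourier n f (transpose B *v k) - fourier n f k))\<^sup>2)
    = real (n\<^sup>2) * (\<Sum>x\<in>torus n. (cmod (f x - f (reduce n (A *v x))))\<^sup>2)"
  using parseval[OF assms(1), of "\<lambda>x. f x - f (reduce n (A *v x))"]
  by (simp add: fourier_diff fourier_matrix[OF assms] norm_minus_commute)

section \<open>Centred representatives\<close>

text \<open>This is the balanced residue; for even \<open>n\<close> the class of
  \<open>n / 2\<close> is represented by its negative. Hence \<open>abs_centre_le\<close> allows
  equality while \<open>centre_small\<close> assumes a strict inequality.\<close>

definition centre :: "nat \<Rightarrow> int \<Rightarrow> int" where
  "centre n z = (z + int n div 2) mod int n - int n div 2"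

lemma centre_cong: "int n dvd z - w \<Longrightarrow> centre n z = centre n w"
  by (simp add: centre_def mod_eq_dvd_iff)

lemma dvd_diff_centre: "int n dvd z - centre n z"
proof -
  have "int n dvd (z + int n div 2) - (z + int n div 2) mod int n"
    by simp
  then show ?thesis
    by (simp add: centre_def algebra_simps)
qed

lemma abs_centre_le:
  assumes "n > 0"
  shows "2 * \<bar>centre n z\<bar> \<le> int n"
proof -
  have "0 \<le> (z + int n div 2) mod int n" "(z + int n div 2) mod int n < int n"
    using assms by simp_all
  moreover have "2 * (int n div 2) \<le> int n" "int n \<le> 2 * (int n div 2) + 1"
    by linarith+
  ultimately show ?thesis
    unfolding centre_def abs_if by (simp split: if_split)
qed

lemma centre_small: "2 * \<bar>z\<bar> < int n \<Longrightarrow> centre n z = z"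
  unfolding centre_def by (subst mod_pos_pos_trivial) linarith+

lemma centre_eq_0_iff: "centre n z = 0 \<longleftrightarrow> int n dvd z"
  using dvd_diff_centre[of n z] centre_cong[of n z 0] centre_small[of 0 n]
  by (cases "n = 0") auto

lemma norm_char_mod_minus_1: "(cmod (char_mod n z - 1))\<^sup>2 = 2 - 2 * cos (2 * pi * of_int z / of_nat n)"
proof -
  let ?t = "2 * pi * of_int z / of_nat n"
  have "(cmod (char_mod n z - 1))\<^sup>2 = (cos ?t - 1)\<^sup>2 + (sin ?t)\<^sup>2"
    by (simp add: char_mod_def cmod_power2)
  also have "\<dots> = 2 - 2 * cos ?t"
    using sin_cos_squared_add[of ?t] by (simp add: power2_eq_square algebra_simps)
  finally show ?thesis .
qed

text \<open>By \<open>abs_centre_le\<close> the angle of the centred representative has absolute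
  value at most \<pi>, and the cosine decreases on [0, \<pi>].\<close>

lemma norm_char_mod_minus_1_ge:
  fixes \<theta> :: real
  assumes "n > 0" "0 \<le> \<theta>" "of_int \<bar>centre n z\<bar> \<ge> \<theta> * n"
  shows "(cmod (char_mod n z - 1))\<^sup>2 \<ge> 2 - 2 * cos (2 * pi * \<theta>)"
proof -
  let ?t = "2 * pi * \<bar>of_int (centre n z)\<bar> / real n"
  have "char_mod n z = char_mod n (centre n z)"
    by (intro char_mod_cong assms dvd_diff_centre)
  then have "(cmod (char_mod n z - 1))\<^sup>2 = 2 - 2 * cos (2 * pi * of_int (centre n z) / of_nat n)"
    by (simp add: norm_char_mod_minus_1)
  moreover have "cos (2 * pi * of_int (centre n z) / of_nat n) = cos ?t"
    by (cases "centre n z \<ge> 0") auto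
  moreover have "cos ?t \<le> cos (2 * pi * \<theta>)"
  proof (rule cos_monotone_0_pi_le)
    have "real_of_int (2 * \<bar>centre n z\<bar>) \<le> real n"
      using abs_centre_le[OF assms(1), of z] by linarith
    then show "?t \<le> pi"
      using assms(1) by (simp add: field_simps)
    show "2 * pi * \<theta> \<le> ?t"
      using assms by (simp add: field_simps)
  qed (use assms in simp)
  ultimately show ?thesis by simp
qed

section \<open>The Rayleigh quotient of a symmetric matrix along its orbits\<close>

text \<open>At the origin division by zero gives 0, so the bound below holds there as well.\<close>

definition sym_rayleigh :: "real \<Rightarrow> real \<Rightarrow> real \<Rightarrow> real \<Rightarrow> real \<Rightarrow> real" where
  "sym_rayleigh \<alpha> \<beta> \<gamma> x y = (\<alpha> * x\<^sup>2 + 2 * \<beta> * x * y + \<gamma> * y\<^sup>2) / (x\<^sup>2 + y\<^sup>2)"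

lemma abs_sym_rayleigh_le: "\<bar>sym_rayleigh \<alpha> \<beta> \<gamma> x y\<bar> \<le> \<bar>\<alpha>\<bar> + \<bar>\<beta>\<bar> + \<bar>\<gamma>\<bar>"
proof (cases "x\<^sup>2 + y\<^sup>2 = 0")
  case False
  then have pos: "x\<^sup>2 + y\<^sup>2 > 0"
    by (metis less_eq_real_def sum_power2_ge_zero)
  have "\<bar>2 * (x * y)\<bar> \<le> x\<^sup>2 + y\<^sup>2"
    using sum_squares_bound[of "\<bar>x\<bar>" "\<bar>y\<bar>"] by (simp add: abs_mult)
  then have "\<bar>\<beta>\<bar> * \<bar>2 * (x * y)\<bar> \<le> \<bar>\<beta>\<bar> * (x\<^sup>2 + y\<^sup>2)"
    by (intro mult_left_mono) auto
  moreover have "\<bar>\<alpha> * x\<^sup>2 + \<beta> * (2 * (x * y)) + \<gamma> * y\<^sup>2\<bar>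
      \<le> \<bar>\<alpha>\<bar> * x\<^sup>2 + \<bar>\<beta>\<bar> * \<bar>2 * (x * y)\<bar> + \<bar>\<gamma>\<bar> * y\<^sup>2"
    by (rule order_trans[OF abs_triangle_ineq] add_mono order_trans[OF abs_triangle_ineq])+
       (simp_all add: abs_mult)
  moreover have "\<bar>\<alpha>\<bar> * x\<^sup>2 + \<bar>\<beta>\<bar> * (x\<^sup>2 + y\<^sup>2) + \<bar>\<gamma>\<bar> * y\<^sup>2 \<le> (\<bar>\<alpha>\<bar> + \<bar>\<beta>\<bar> + \<bar>\<gamma>\<bar>) * (x\<^sup>2 + y\<^sup>2)"
    by (simp add: algebra_simps)
  ultimately have "\<bar>\<alpha> * x\<^sup>2 + \<beta> * (2 * (x * y)) + \<gamma> * y\<^sup>2\<bar> \<le> (\<bar>\<alpha>\<bar> + \<bar>\<beta>\<bar> + \<bar>\<gamma>\<bar>) * (x\<^sup>2 + y\<^sup>2)"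
    by linarith
  then show ?thesis
    using pos by (simp add: sym_rayleigh_def pos_divide_le_eq mult_ac)
qed (simp add: sym_rayleigh_def)

text \<open>Let h be the symmetric matrix and v = (x, y). Cayley-Hamilton gives |hv|^2 = tr(h) <v,
  hv> - det(h) |v|^2 and <hv, h(hv)> = tr(h) |hv|^2 - det(h) <v, hv>. The numerator of the
  difference becomes tr(h) (|v|^2 |hv|^2 - <v, hv>^2), and by Lagrange's identity the bracket is the
  square of det(v, hv).\<close>

lemma sym_rayleigh_increment:
  fixes x y :: real
  assumes "x\<^sup>2 + y\<^sup>2 \<noteq> 0" "(\<alpha> * x + \<beta> * y)\<^sup>2 + (\<beta> * x + \<gamma> * y)\<^sup>2 \<noteq> 0"
  shows "sym_rayleigh \<alpha> \<beta> \<gamma> (\<alpha> * x + \<beta> * y) (\<beta> * x + \<gamma> * y) - sym_rayleigh \<alpha> \<beta> \<gamma> x y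
    = (\<alpha> + \<gamma>) * (\<beta> * (x\<^sup>2 - y\<^sup>2) + (\<gamma> - \<alpha>) * (x * y))\<^sup>2
      / ((x\<^sup>2 + y\<^sup>2) * ((\<alpha> * x + \<beta> * y)\<^sup>2 + (\<beta> * x + \<gamma> * y)\<^sup>2))"
  unfolding sym_rayleigh_def diff_frac_eq[OF assms(2,1)]
  by (rule arg_cong2[where f = "(/)"]) (simp_all add: power2_eq_square algebra_simps)

lemma sym_rayleigh_increment_ge:
  fixes x y :: real
  assumes "x\<^sup>2 + y\<^sup>2 \<noteq> 0" "(\<alpha> * x + \<beta> * y)\<^sup>2 + (\<beta> * x + \<gamma> * y)\<^sup>2 \<noteq> 0" "\<alpha> + \<gamma> \<ge> 1"
    and H: "\<alpha>\<^sup>2 + 2 * \<beta>\<^sup>2 + \<gamma>\<^sup>2 \<le> H"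
  shows "sym_rayleigh \<alpha> \<beta> \<gamma> (\<alpha> * x + \<beta> * y) (\<beta> * x + \<gamma> * y) - sym_rayleigh \<alpha> \<beta> \<gamma> x y
    \<ge> (\<beta> * (x\<^sup>2 - y\<^sup>2) + (\<gamma> - \<alpha>) * (x * y))\<^sup>2 / (H * (x\<^sup>2 + y\<^sup>2)\<^sup>2)"
proof -
  define q where "q = \<beta> * (x\<^sup>2 - y\<^sup>2) + (\<gamma> - \<alpha>) * (x * y)"
  define N where "N = x\<^sup>2 + y\<^sup>2"
  define N' where "N' = (\<alpha> * x + \<beta> * y)\<^sup>2 + (\<beta> * x + \<gamma> * y)\<^sup>2"
  have pos: "N > 0" "N' > 0"
    using assms(1,2) unfolding N_def N'_def by (metis less_eq_real_def sum_power2_ge_zero)+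
  \<comment> \<open>Lagrange's identity for each row bounds \<open>N'\<close> by \<open>N\<close>
    times the squared Hilbert-Schmidt norm of the matrix.\<close>
  have "N' + ((\<alpha> * y - \<beta> * x)\<^sup>2 + (\<beta> * y - \<gamma> * x)\<^sup>2) = (\<alpha>\<^sup>2 + 2 * \<beta>\<^sup>2 + \<gamma>\<^sup>2) * N"
    by (simp add: N_def N'_def power2_eq_square algebra_simps)
  then have "N' \<le> (\<alpha>\<^sup>2 + 2 * \<beta>\<^sup>2 + \<gamma>\<^sup>2) * N"
    using sum_power2_ge_zero[of "\<alpha> * y - \<beta> * x" "\<beta> * y - \<gamma> * x"] by linarith
  also have "\<dots> \<le> H * N"
    using H pos by (intro mult_right_mono) simp_all
  finally have "N * N' \<le> H * N\<^sup>2"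
    using pos by (simp add: power2_eq_square mult_ac)
  then have "q\<^sup>2 / (H * N\<^sup>2) \<le> (\<alpha> + \<gamma>) * q\<^sup>2 / (N * N')"
    using pos assms(3) by (intro frac_le) (simp_all add: mult_le_cancel_right1)
  then show ?thesis
    unfolding sym_rayleigh_increment[OF assms(1,2)] q_def N_def N'_def .
qed

text \<open>Both forms are linear in X = x^2 - y^2 and Y = x y, so Cramer's rule recovers X and Y
  from them up to a determinant of absolute value at least 1. The factor 4 comes from (x^2 + y^2)^2
  = X^2 + 4 Y^2.\<close>

lemma two_quadratic_forms_ge:
  fixes p r p' r' x y :: real
  assumes "(p * r' - p' * r)\<^sup>2 \<ge> 1"
  shows "(x\<^sup>2 + y\<^sup>2)\<^sup>2 \<le> (4 * (p\<^sup>2 + p'\<^sup>2) + (r\<^sup>2 + r'\<^sup>2))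
    * ((p * (x\<^sup>2 - y\<^sup>2) + r * (x * y))\<^sup>2 + (p' * (x\<^sup>2 - y\<^sup>2) + r' * (x * y))\<^sup>2)"
proof -
  define X Y where "X = x\<^sup>2 - y\<^sup>2" and "Y = x * y"
  define q q' where "q = p * X + r * Y" and "q' = p' * X + r' * Y"
  have cauchy: "(u * q' - v * q)\<^sup>2 \<le> (u\<^sup>2 + v\<^sup>2) * (q\<^sup>2 + q'\<^sup>2)" for u v
  proof -
    have "(u\<^sup>2 + v\<^sup>2) * (q\<^sup>2 + q'\<^sup>2) - (u * q' - v * q)\<^sup>2 = (u * q + v * q')\<^sup>2"
      by (simp add: power2_eq_square algebra_simps)
    then show ?thesis
      using zero_le_power2[of "u * q + v * q'"] by linarith
  qed
  have le: "z\<^sup>2 \<le> (p * r' - p' * r)\<^sup>2 * z\<^sup>2" for z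
    using mult_right_mono[OF assms, of "z\<^sup>2"] by simp
  have "X\<^sup>2 \<le> (r * q' - r' * q)\<^sup>2"
    using le[of X] by (simp add: q_def q'_def power2_eq_square algebra_simps)
  moreover have "Y\<^sup>2 \<le> (p * q' - p' * q)\<^sup>2"
    using le[of Y] by (simp add: q_def q'_def power2_eq_square algebra_simps)
  moreover have "(x\<^sup>2 + y\<^sup>2)\<^sup>2 = X\<^sup>2 + 4 * Y\<^sup>2"
    by (simp add: X_def Y_def power2_eq_square algebra_simps)
  ultimately have "(x\<^sup>2 + y\<^sup>2)\<^sup>2 \<le> (4 * (p\<^sup>2 + p'\<^sup>2) + (r\<^sup>2 + r'\<^sup>2)) * (q\<^sup>2 + q'\<^sup>2)"
    using cauchy[of r r'] cauchy[of p p'] by (simp add: ring_distribs)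
  then show ?thesis
    by (simp add: q_def q'_def X_def Y_def)
qed

section \<open>The Rayleigh quotient on the dual torus\<close>

definition torus_rayleigh :: "nat \<Rightarrow> int \<Rightarrow> int \<Rightarrow> int \<Rightarrow> int^2 \<Rightarrow> real" where
  "torus_rayleigh n \<alpha> \<beta> \<gamma> k = sym_rayleigh \<alpha> \<beta> \<gamma> (centre n (k $ 1)) (centre n (k $ 2))"

lemma torus_rayleigh_reduce [simp]: "torus_rayleigh n \<alpha> \<beta> \<gamma> (reduce n k) = torus_rayleigh n \<alpha> \<beta> \<gamma> k"
proof -
  have "centre n (z mod int n) = centre n z" for z
    by (rule centre_cong) (simp add: mod_eq_dvd_iff[symmetric])
  then show ?thesis
    by (simp add: torus_rayleigh_def)
qed

text \<open>Near the origin the action modulo \<open>n\<close> is the linear action on centred representatives.\<close>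

lemma torus_rayleigh_increment_ge:
  fixes \<alpha> \<beta> \<gamma> :: int and A :: "int^2^2"
  assumes A: "A = vector [vector [\<alpha>, \<beta>], vector [\<beta>, \<gamma>]]"
    and det: "\<alpha> * \<gamma> - \<beta> * \<beta> \<noteq> 0" and tr: "\<alpha> + \<gamma> \<ge> 1"
    and H: "\<alpha>\<^sup>2 + 2 * \<beta>\<^sup>2 + \<gamma>\<^sup>2 \<le> H"
    and xy: "x = centre n (k $ 1)" "y = centre n (k $ 2)" "(x, y) \<noteq> (0, 0)"
    and small: "2 * (\<bar>\<alpha>\<bar> + \<bar>\<beta>\<bar> + \<bar>\<gamma>\<bar>) * \<bar>x\<bar> < n" "2 * (\<bar>\<alpha>\<bar> + \<bar>\<beta>\<bar> + \<bar>\<gamma>\<bar>) * \<bar>y\<bar> < n"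
  shows "torus_rayleigh n \<alpha> \<beta> \<gamma> (A *v k) - torus_rayleigh n \<alpha> \<beta> \<gamma> k
    \<ge> (of_int \<beta> * ((of_int x)\<^sup>2 - (of_int y)\<^sup>2) + of_int (\<gamma> - \<alpha>) * (of_int x * of_int y))\<^sup>2
      / (of_int H * ((of_int x)\<^sup>2 + (of_int y)\<^sup>2)\<^sup>2)"
proof -
  \<comment> \<open>By the smallness assumptions a row of \<open>A\<close> applied to the centred
    representative has absolute value below n/2, so no wrap-around modulo \<open>n\<close>
    occurs.\<close>
  have lin: "centre n (u * k $ 1 + v * k $ 2) = u * x + v * y"
    if uv: "\<bar>u\<bar> + \<bar>v\<bar> \<le> \<bar>\<alpha>\<bar> + \<bar>\<beta>\<bar> + \<bar>\<gamma>\<bar>" for u v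
  proof -
    have "int n dvd u * (k $ 1 - x) + v * (k $ 2 - y)"
      unfolding xy by (intro dvd_add dvd_mult dvd_diff_centre)
    then have "centre n (u * k $ 1 + v * k $ 2) = centre n (u * x + v * y)"
      by (intro centre_cong) (simp add: algebra_simps)
    also have "\<dots> = u * x + v * y"
    proof (rule centre_small)
      have "2 * \<bar>u * x + v * y\<bar> \<le> 2 * (\<bar>u\<bar> * \<bar>x\<bar> + \<bar>v\<bar> * \<bar>y\<bar>)"
        using abs_triangle_ineq[of "u * x" "v * y"] by (simp add: abs_mult)
      also have "\<dots> \<le> 2 * ((\<bar>u\<bar> + \<bar>v\<bar>) * max \<bar>x\<bar> \<bar>y\<bar>)"
        by (simp add: ring_distribs add_mono mult_left_mono)
      also have "\<dots> \<le> 2 * ((\<bar>\<alpha>\<bar> + \<bar>\<beta>\<bar> + \<bar>\<gamma>\<bar>) * max \<bar>x\<bar> \<bar>y\<bar>)"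
        using uv by (intro mult_left_mono mult_right_mono) auto
      also have "\<dots> < n"
        using small by (cases "\<bar>x\<bar> \<le> \<bar>y\<bar>") (simp_all only: max_def if_True if_False mult.assoc)
      finally show "2 * \<bar>u * x + v * y\<bar> < int n" .
    qed
    finally show ?thesis .
  qed
  have Ak: "(A *v k) $ 1 = \<alpha> * k $ 1 + \<beta> * k $ 2" "(A *v k) $ 2 = \<beta> * k $ 1 + \<gamma> * k $ 2"
    by (simp_all add: A matrix_vector_mult_def sum_2)
  have "torus_rayleigh n \<alpha> \<beta> \<gamma> (A *v k) = sym_rayleigh \<alpha> \<beta> \<gamma> (of_int (\<alpha> * x + \<beta> * y)) (of_int (\<beta> * x + \<gamma> * y))"
    unfolding torus_rayleigh_def Ak by (subst (1 2) lin) auto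
  moreover have "torus_rayleigh n \<alpha> \<beta> \<gamma> k = sym_rayleigh \<alpha> \<beta> \<gamma> x y"
    by (simp add: torus_rayleigh_def xy)
  moreover have "(\<alpha> * x + \<beta> * y)\<^sup>2 + (\<beta> * x + \<gamma> * y)\<^sup>2 \<noteq> 0"
  proof
    assume "(\<alpha> * x + \<beta> * y)\<^sup>2 + (\<beta> * x + \<gamma> * y)\<^sup>2 = 0"
    then have eqs: "\<alpha> * x + \<beta> * y = 0" "\<beta> * x + \<gamma> * y = 0"
      by (simp_all add: sum_power2_eq_zero_iff)
    have "(\<alpha> * \<gamma> - \<beta> * \<beta>) * x = \<gamma> * (\<alpha> * x + \<beta> * y) - \<beta> * (\<beta> * x + \<gamma> * y)"
      "(\<alpha> * \<gamma> - \<beta> * \<beta>) * y = \<alpha> * (\<beta> * x + \<gamma> * y) - \<beta> * (\<alpha> * x + \<beta> * y)"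
      by (simp_all add: algebra_simps)
    with eqs det xy(3) show False by simp
  qed
  then have "real_of_int ((\<alpha> * x + \<beta> * y)\<^sup>2 + (\<beta> * x + \<gamma> * y)\<^sup>2) \<noteq> 0"
    by (simp only: of_int_eq_0_iff not_False_eq_True)
  moreover have "real_of_int (\<alpha>\<^sup>2 + 2 * \<beta>\<^sup>2 + \<gamma>\<^sup>2) \<le> of_int H" "real_of_int (\<alpha> + \<gamma>) \<ge> 1"
    using H tr by linarith+
  moreover have "(real_of_int x)\<^sup>2 + (real_of_int y)\<^sup>2 \<noteq> 0"
    using xy(3) by (simp add: sum_power2_eq_zero_iff)
  ultimately show ?thesis
    using sym_rayleigh_increment_ge[of x y \<alpha> \<beta> \<gamma> H] by simp
qed

section \<open>Almost invariant measures on the dual torus\<close>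

text \<open>The left side is at most |u - v| (|u| + |v|), and the weighted inequality between
  arithmetic and geometric means splits this product. The weight \<open>s\<close> stays free so that
  the second term can later be absorbed.\<close>

lemma norm_square_diff_le:
  fixes u v :: complex
  assumes "s > 0"
  shows "\<bar>(cmod u)\<^sup>2 - (cmod v)\<^sup>2\<bar> \<le> s * (cmod (u - v))\<^sup>2 + ((cmod u)\<^sup>2 + (cmod v)\<^sup>2) / (2 * s)"
proof -
  define p q d where "p = cmod u" and "q = cmod v" and "d = cmod (u - v)"
  have "\<bar>p\<^sup>2 - q\<^sup>2\<bar> = \<bar>p - q\<bar> * (p + q)"
    by (simp add: p_def q_def power2_eq_square square_diff_square_factored abs_mult mult.commute)
  also have "\<dots> \<le> d * (p + q)"
    unfolding p_def q_def d_def by (intro mult_right_mono norm_triangle_ineq3) simp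
  finally have "2 * s * \<bar>p\<^sup>2 - q\<^sup>2\<bar> \<le> 2 * s * (d * (p + q))"
    using assms by (intro mult_left_mono) simp_all
  also have "\<dots> \<le> 2 * s\<^sup>2 * d\<^sup>2 + (p\<^sup>2 + q\<^sup>2)"
    using zero_le_power2[of "2 * s * d - (p + q)"] zero_le_power2[of "p - q"]
    by (simp add: power2_eq_square algebra_simps)
  also have "\<dots> = 2 * s * (s * d\<^sup>2 + (p\<^sup>2 + q\<^sup>2) / (2 * s))"
    using assms by (simp add: power2_eq_square field_simps)
  finally show ?thesis
    using assms by (simp add: p_def q_def d_def)
qed

text \<open>If |F|^2 were invariant under \<open>A\<close>, the left side would vanish by
  reindexing. Reindexing moves \<open>A\<close> from \<phi> to the mass, and
  \<open>norm_square_diff_le\<close> measures the failure of invariance.\<close>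

lemma sum_increment_le:
  fixes A B :: "int^2^2" and F :: "int^2 \<Rightarrow> complex" and \<phi> :: "int^2 \<Rightarrow> real"
  assumes AB: "n > 0" "A ** B = mat 1" "B ** A = mat 1"
    and F: "\<And>k. F (reduce n k) = F k" and \<phi>: "\<And>k. \<phi> (reduce n k) = \<phi> k" "\<And>k. \<bar>\<phi> k\<bar> \<le> C"
    and s: "s > 0"
  shows "(\<Sum>k\<in>torus n. (\<phi> (A *v k) - \<phi> k) * (cmod (F k))\<^sup>2)
    \<le> C * (s * (\<Sum>k\<in>torus n. (cmod (F (A *v k) - F k))\<^sup>2) + (\<Sum>k\<in>torus n. (cmod (F k))\<^sup>2) / s)"
proof -
  have shift: "(\<Sum>k\<in>torus n. g (A *v k)) = sum g (torus n)"
    if "\<And>k. g (reduce n k) = g k" for g :: "int^2 \<Rightarrow> real"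
    using sum.reindex_bij_betw[OF bij_betw_torus_matrix[OF AB], of g] that by simp
  let ?N = "\<lambda>k. (cmod (F k))\<^sup>2"
  have "(\<Sum>k\<in>torus n. (\<phi> (A *v k) - \<phi> k) * ?N k)
      = (\<Sum>k\<in>torus n. \<phi> (A *v k) * ?N k) - (\<Sum>k\<in>torus n. \<phi> k * ?N k)"
    by (simp add: left_diff_distrib sum_subtractf)
  also have "(\<Sum>k\<in>torus n. \<phi> k * ?N k) = (\<Sum>k\<in>torus n. \<phi> (A *v k) * ?N (A *v k))"
    by (rule shift[symmetric]) (simp add: F \<phi>)
  also have "(\<Sum>k\<in>torus n. \<phi> (A *v k) * ?N k) - \<dots> = (\<Sum>k\<in>torus n. \<phi> (A *v k) * (?N k - ?N (A *v k)))"
    by (simp add: right_diff_distrib sum_subtractf)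
  also have "\<dots> \<le> (\<Sum>k\<in>torus n. C * (s * (cmod (F (A *v k) - F k))\<^sup>2 + (?N (A *v k) + ?N k) / (2 * s)))"
  proof (rule sum_mono)
    fix k
    have "\<phi> (A *v k) * (?N k - ?N (A *v k)) \<le> \<bar>\<phi> (A *v k)\<bar> * \<bar>?N (A *v k) - ?N k\<bar>"
      by (metis abs_ge_self abs_minus_commute abs_mult)
    also have "\<dots> \<le> C * (s * (cmod (F (A *v k) - F k))\<^sup>2 + (?N (A *v k) + ?N k) / (2 * s))"
      using \<phi>(2)[of "A *v k"] by (intro mult_mono norm_square_diff_le[OF s] \<phi>(2)) auto
    finally show "\<phi> (A *v k) * (?N k - ?N (A *v k))
      \<le> C * (s * (cmod (F (A *v k) - F k))\<^sup>2 + (?N (A *v k) + ?N k) / (2 * s))" .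
  qed
  also have "\<dots> = C * (s * (\<Sum>k\<in>torus n. (cmod (F (A *v k) - F k))\<^sup>2)
      + ((\<Sum>k\<in>torus n. ?N (A *v k)) + (\<Sum>k\<in>torus n. ?N k)) / (2 * s))"
    by (simp add: sum_distrib_left sum.distrib sum_divide_distrib ring_distribs add_divide_distrib)
  also have "(\<Sum>k\<in>torus n. ?N (A *v k)) = (\<Sum>k\<in>torus n. ?N k)"
    by (rule shift) (simp add: F)
  finally show ?thesis
    by simp
qed

text \<open>The defect at \<open>k\<close> is the defect of \<open>A\<close> at
  \<open>B *v k\<close> plus that of \<open>B\<close> at \<open>k\<close>; the first is reindexed
  along \<open>B\<close>.\<close>

lemma sum_product_defect_le:
  fixes A B :: "int^2^2" and F :: "int^2 \<Rightarrow> complex"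
  assumes B: "n > 0" "B ** B' = mat 1" "B' ** B = mat 1"
    and F: "\<And>k. F (reduce n k) = F k"
  shows "(\<Sum>k\<in>torus n. (cmod (F ((A ** B) *v k) - F k))\<^sup>2)
    \<le> 2 * ((\<Sum>k\<in>torus n. (cmod (F (A *v k) - F k))\<^sup>2) + (\<Sum>k\<in>torus n. (cmod (F (B *v k) - F k))\<^sup>2))"
proof -
  have F_matrix: "F (A *v reduce n k) = F (A *v k)" for k
    by (metis F reduce_matrix_vector_mult)
  have "(cmod (F ((A ** B) *v k) - F k))\<^sup>2
      \<le> 2 * (cmod (F (A *v (B *v k)) - F (B *v k)))\<^sup>2 + 2 * (cmod (F (B *v k) - F k))\<^sup>2" for k
  proof -
    let ?u = "F (A *v (B *v k)) - F (B *v k)" and ?v = "F (B *v k) - F k"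
    have "(cmod (?u + ?v))\<^sup>2 \<le> (cmod ?u + cmod ?v)\<^sup>2"
      by (intro power_mono norm_triangle_ineq) simp
    also have "\<dots> \<le> 2 * (cmod ?u)\<^sup>2 + 2 * (cmod ?v)\<^sup>2"
      using sum_squares_bound[of "cmod ?u" "cmod ?v"] by (simp add: power2_sum)
    finally show ?thesis
      by (simp add: matrix_vector_mul_assoc)
  qed
  then have "(\<Sum>k\<in>torus n. (cmod (F ((A ** B) *v k) - F k))\<^sup>2)
      \<le> (\<Sum>k\<in>torus n. 2 * (cmod (F (A *v (B *v k)) - F (B *v k)))\<^sup>2 + 2 * (cmod (F (B *v k) - F k))\<^sup>2)"
    by (rule sum_mono)
  also have "\<dots> = 2 * ((\<Sum>k\<in>torus n. (cmod (F (A *v (B *v k)) - F (B *v k)))\<^sup>2)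
      + (\<Sum>k\<in>torus n. (cmod (F (B *v k) - F k))\<^sup>2))"
    by (simp add: sum.distrib sum_distrib_left)
  also have "(\<Sum>k\<in>torus n. (cmod (F (A *v (B *v k)) - F (B *v k)))\<^sup>2)
      = (\<Sum>k\<in>torus n. (cmod (F (A *v k) - F k))\<^sup>2)"
    using sum.reindex_bij_betw[OF bij_betw_torus_matrix[OF B],
        of "\<lambda>k. (cmod (F (A *v k) - F k))\<^sup>2"] by (simp add: F F_matrix)
  finally show ?thesis .
qed

text \<open>Near the origin the two quadratic forms are independent by \<open>indep\<close>, which
  bounds the sum of the increments below by \<kappa>. Elsewhere the increments are merely bounded,
  but there the translation weight is bounded below, and a large \<open>W\<close>
  compensates.\<close>

lemma torus_rayleigh_increments_ge:
  fixes \<alpha> \<beta> \<gamma> \<alpha>' \<beta>' \<gamma>' :: int and A A' :: "int^2^2"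
  assumes A: "A = vector [vector [\<alpha>, \<beta>], vector [\<beta>, \<gamma>]]"
    and A': "A' = vector [vector [\<alpha>', \<beta>'], vector [\<beta>', \<gamma>']]"
    and det: "\<alpha> * \<gamma> - \<beta> * \<beta> \<noteq> 0" "\<alpha>' * \<gamma>' - \<beta>' * \<beta>' \<noteq> 0"
    and tr: "\<alpha> + \<gamma> \<ge> 1" "\<alpha>' + \<gamma>' \<ge> 1"
    and indep: "\<beta> * (\<gamma>' - \<alpha>') - \<beta>' * (\<gamma> - \<alpha>) \<noteq> 0"
  obtains \<kappa> W where "\<kappa> > 0" "W > 0"
    "\<And>n k. n > 0 \<Longrightarrow> reduce n k \<noteq> 0 \<Longrightarrow>
      (torus_rayleigh n \<alpha> \<beta> \<gamma> (A *v k) - torus_rayleigh n \<alpha> \<beta> \<gamma> k) + (torus_rayleigh n \<alpha>' \<beta>' \<gamma>' (A' *v k) - torus_rayleigh n \<alpha>' \<beta>' \<gamma>' k)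
      \<ge> \<kappa> - W * ((cmod (char_mod n (k $ 1) - 1))\<^sup>2 + (cmod (char_mod n (k $ 2) - 1))\<^sup>2)"
proof -
  define L where "L = \<bar>\<alpha>\<bar> + \<bar>\<beta>\<bar> + \<bar>\<gamma>\<bar>"
  define L' where "L' = \<bar>\<alpha>'\<bar> + \<bar>\<beta>'\<bar> + \<bar>\<gamma>'\<bar>"
  have L: "L \<ge> 1" "L' \<ge> 1"
    using tr unfolding L_def L'_def by linarith+
  define H where "H = (\<alpha>\<^sup>2 + 2 * \<beta>\<^sup>2 + \<gamma>\<^sup>2) + (\<alpha>'\<^sup>2 + 2 * \<beta>'\<^sup>2 + \<gamma>'\<^sup>2)"
  have H: "\<alpha>\<^sup>2 + 2 * \<beta>\<^sup>2 + \<gamma>\<^sup>2 \<le> H" "\<alpha>'\<^sup>2 + 2 * \<beta>'\<^sup>2 + \<gamma>'\<^sup>2 \<le> H"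
    by (simp_all add: H_def)
  have "\<alpha> \<noteq> 0 \<or> \<gamma> \<noteq> 0"
    using tr by auto
  then have "\<alpha>\<^sup>2 + \<gamma>\<^sup>2 > 0"
    by (simp add: sum_power2_gt_zero_iff)
  then have H_pos: "H > 0"
    using zero_le_power2[of \<beta>] zero_le_power2[of \<alpha>'] zero_le_power2[of \<beta>'] zero_le_power2[of \<gamma>']
    unfolding H_def by linarith
  define R :: real where "R = 4 * ((of_int \<beta>)\<^sup>2 + (of_int \<beta>')\<^sup>2)
    + ((of_int (\<gamma> - \<alpha>))\<^sup>2 + (of_int (\<gamma>' - \<alpha>'))\<^sup>2)"
  have indep_real: "(real_of_int \<beta> * of_int (\<gamma>' - \<alpha>') - of_int \<beta>' * of_int (\<gamma> - \<alpha>))\<^sup>2 \<ge> 1"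
  proof -
    have "(\<beta> * (\<gamma>' - \<alpha>') - \<beta>' * (\<gamma> - \<alpha>))\<^sup>2 \<ge> 1"
      using indep by (metis zero_less_power2 int_one_le_iff_zero_less)
    then have "real_of_int ((\<beta> * (\<gamma>' - \<alpha>') - \<beta>' * (\<gamma> - \<alpha>))\<^sup>2) \<ge> 1"
      by linarith
    then show ?thesis by simp
  qed
  \<comment> \<open>At the point (1, 0) the inequality bounds 1 by a multiple of
    \<open>R\<close>.\<close>
  have "R \<noteq> 0"
    using two_quadratic_forms_ge[OF indep_real, of 1 0] by (auto simp: R_def)
  moreover have "R \<ge> 0"
    by (simp add: R_def)
  ultimately have R_pos: "R > 0" by simp
  \<comment> \<open>\<open>R\<close> comes from \<open>two_quadratic_forms_ge\<close> and
    \<open>H\<close> from the denominators of the increments.\<close>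
  define \<kappa> where "\<kappa> = 1 / (R * of_int H)"
  \<comment> \<open>Centred coordinates below \<theta> n in absolute value are small enough for both
    matrices to act without wrap-around.\<close>
  define \<theta> where "\<theta> = 1 / (4 * real_of_int (L + L'))"
  define e where "e = 2 - 2 * cos (2 * pi * \<theta>)"
  define M where "M = real_of_int (2 * L + 2 * L')"
  have \<kappa>: "\<kappa> > 0"
    using R_pos H_pos by (simp add: \<kappa>_def)
  have \<theta>: "0 < \<theta>" "\<theta> \<le> 1 / 2"
    using L by (auto simp: \<theta>_def field_simps)
  have "cos (2 * pi * \<theta>) < cos 0"
    using \<theta> by (intro cos_monotone_0_pi) auto
  then have e: "e > 0"
    by (simp add: e_def)
  have M: "M \<ge> 0"
    using L by (simp add: M_def)
  \<comment> \<open>Where the translation weight is at least \<open>e\<close>, the lower bound is at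
    most -\<open>M\<close>, and \<open>M\<close> bounds the absolute value of the two increments
    together.\<close>
  define W where "W = (\<kappa> + M) / e"
  have W: "W > 0"
    using \<kappa> e M by (simp add: W_def)
  show ?thesis
  proof (rule that[OF \<kappa> W])
    fix n :: nat and k :: "int^2"
    assume n: "n > 0" and k: "reduce n k \<noteq> 0"
    define x y where "x = centre n (k $ 1)" and "y = centre n (k $ 2)"
    define D where "D = (torus_rayleigh n \<alpha> \<beta> \<gamma> (A *v k) - torus_rayleigh n \<alpha> \<beta> \<gamma> k)
      + (torus_rayleigh n \<alpha>' \<beta>' \<gamma>' (A' *v k) - torus_rayleigh n \<alpha>' \<beta>' \<gamma>' k)"
    define w where "w = (cmod (char_mod n (k $ 1) - 1))\<^sup>2 + (cmod (char_mod n (k $ 2) - 1))\<^sup>2"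
    have "D \<ge> \<kappa> - W * w"
    proof (cases "\<bar>x\<bar> \<ge> \<theta> * n \<or> \<bar>y\<bar> \<ge> \<theta> * n")
      case True
      then have "w \<ge> e"
        using norm_char_mod_minus_1_ge[OF n, of \<theta> "k $ 1"] norm_char_mod_minus_1_ge[OF n, of \<theta> "k $ 2"] \<theta>
        by (auto simp: w_def e_def x_def y_def add_increasing add_increasing2)
      then have "\<kappa> + M \<le> W * w"
        using mult_left_mono[of e w "\<kappa> + M"] \<kappa> M e by (simp add: W_def field_simps)
      moreover have "\<bar>torus_rayleigh n \<alpha> \<beta> \<gamma> l\<bar> \<le> L" "\<bar>torus_rayleigh n \<alpha>' \<beta>' \<gamma>' l\<bar> \<le> L'" for l
        by (simp_all add: torus_rayleigh_def L_def L'_def abs_sym_rayleigh_le)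
      from this[of k] this(1)[of "A *v k"] this(2)[of "A' *v k"] have "\<bar>D\<bar> \<le> M"
        unfolding D_def M_def of_int_add of_int_mult of_int_numeral by linarith
      ultimately show ?thesis by linarith
    next
      case False
      have small: "2 * l * \<bar>z\<bar> < int n" if "\<bar>z\<bar> < \<theta> * n" "l \<le> L + L'" for l z
      proof -
        have "2 * l * \<bar>z\<bar> \<le> 2 * (L + L') * \<bar>z\<bar>"
          using that(2) by (intro mult_right_mono) auto
        moreover have "real_of_int (4 * (L + L') * \<bar>z\<bar>) < real n"
          using that(1) L by (simp add: \<theta>_def field_simps)
        then have "4 * (L + L') * \<bar>z\<bar> < int n"
          by linarith
        moreover have "2 * (L + L') * \<bar>z\<bar> \<le> 4 * (L + L') * \<bar>z\<bar>"
          using L by (intro mult_right_mono) auto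
        ultimately show ?thesis by linarith
      qed
      have xy: "(x, y) \<noteq> (0, 0)"
        using k by (auto simp: x_def y_def centre_eq_0_iff vec_eq_iff forall_2 dvd_eq_mod_eq_0)
      define X Y where "X = real_of_int x" and "Y = real_of_int y"
      have N_pos: "X\<^sup>2 + Y\<^sup>2 > 0"
        using xy by (simp add: X_def Y_def sum_power2_gt_zero_iff)
      define Q where "Q = (of_int \<beta> * (X\<^sup>2 - Y\<^sup>2) + of_int (\<gamma> - \<alpha>) * (X * Y))\<^sup>2"
      define Q' where "Q' = (of_int \<beta>' * (X\<^sup>2 - Y\<^sup>2) + of_int (\<gamma>' - \<alpha>') * (X * Y))\<^sup>2"
      have "torus_rayleigh n \<alpha> \<beta> \<gamma> (A *v k) - torus_rayleigh n \<alpha> \<beta> \<gamma> k \<ge> Q / (of_int H * (X\<^sup>2 + Y\<^sup>2)\<^sup>2)"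
        unfolding Q_def X_def Y_def
        by (rule torus_rayleigh_increment_ge[OF A det(1) tr(1) H(1) x_def y_def xy];
            rule small; use False L in \<open>simp add: L_def\<close>)
      moreover have "torus_rayleigh n \<alpha>' \<beta>' \<gamma>' (A' *v k) - torus_rayleigh n \<alpha>' \<beta>' \<gamma>' k \<ge> Q' / (of_int H * (X\<^sup>2 + Y\<^sup>2)\<^sup>2)"
        unfolding Q'_def X_def Y_def
        by (rule torus_rayleigh_increment_ge[OF A' det(2) tr(2) H(2) x_def y_def xy];
            rule small; use False L in \<open>simp add: L'_def\<close>)
      ultimately have "D \<ge> (Q + Q') / (of_int H * (X\<^sup>2 + Y\<^sup>2)\<^sup>2)"
        by (simp add: D_def add_divide_distrib)
      moreover have "(X\<^sup>2 + Y\<^sup>2)\<^sup>2 \<le> R * (Q + Q')"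
        using two_quadratic_forms_ge[OF indep_real, of X Y] by (simp only: R_def Q_def Q'_def)
      then have "(X\<^sup>2 + Y\<^sup>2)\<^sup>2 / R \<le> Q + Q'"
        using R_pos by (simp add: pos_divide_le_eq mult.commute)
      then have "(X\<^sup>2 + Y\<^sup>2)\<^sup>2 / R / (of_int H * (X\<^sup>2 + Y\<^sup>2)\<^sup>2)
          \<le> (Q + Q') / (of_int H * (X\<^sup>2 + Y\<^sup>2)\<^sup>2)"
        using H_pos by (intro divide_right_mono) simp_all
      then have "\<kappa> \<le> (Q + Q') / (of_int H * (X\<^sup>2 + Y\<^sup>2)\<^sup>2)"
        using N_pos by (auto simp: \<kappa>_def split: if_splits)
      moreover have "W * w \<ge> 0"
        using W by (simp add: w_def)
      ultimately show ?thesis by linarith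
    qed
    then show "(torus_rayleigh n \<alpha> \<beta> \<gamma> (A *v k) - torus_rayleigh n \<alpha> \<beta> \<gamma> k) + (torus_rayleigh n \<alpha>' \<beta>' \<gamma>' (A' *v k) - torus_rayleigh n \<alpha>' \<beta>' \<gamma>' k)
      \<ge> \<kappa> - W * ((cmod (char_mod n (k $ 1) - 1))\<^sup>2 + (cmod (char_mod n (k $ 2) - 1))\<^sup>2)"
      by (simp only: D_def w_def)
  qed
qed

text \<open>The right side collects the three quantities that edges control after Fourier transform:
  the defects under both matrices and the translation weight. The constant is uniform in
  \<open>n\<close>, because the Rayleigh bounds depend only on the matrix entries.\<close>

lemma dual_spectral_gap:
  fixes a b c d :: int and S T S' T' :: "int^2^2"
  assumes S: "S = vector [vector [a, b], vector [c, d]]"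
    and T: "T = vector [vector [a, c], vector [b, d]]"
    and inv: "S ** S' = mat 1" "S' ** S = mat 1" "T ** T' = mat 1" "T' ** T = mat 1"
    and det: "a * d - b * c = 1 \<or> a * d - b * c = - 1"
    and ne: "(a + d) * (b - c) \<noteq> 0"
  shows "\<exists>C>0. \<forall>n>0. \<forall>F. (\<forall>k. F (reduce n k) = F k) \<longrightarrow> F 0 = 0 \<longrightarrow>
      (\<Sum>k\<in>torus n. (cmod (F k))\<^sup>2) \<le> C *
        (((\<Sum>k\<in>torus n. (cmod (F (S *v k) - F k))\<^sup>2) + (\<Sum>k\<in>torus n. (cmod (F (T *v k) - F k))\<^sup>2))
        + (\<Sum>k\<in>torus n. ((cmod (char_mod n (k $ 1) - 1))\<^sup>2 + (cmod (char_mod n (k $ 2) - 1))\<^sup>2) * (cmod (F k))\<^sup>2))"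
proof -
  define \<alpha> \<beta> \<gamma> where "\<alpha> = a\<^sup>2 + b\<^sup>2" and "\<beta> = a * c + b * d" and "\<gamma> = c\<^sup>2 + d\<^sup>2"
  define \<alpha>' \<beta>' \<gamma>' where "\<alpha>' = a\<^sup>2 + c\<^sup>2" and "\<beta>' = a * b + c * d" and "\<gamma>' = b\<^sup>2 + d\<^sup>2"
  note defs = \<alpha>_def \<beta>_def \<gamma>_def \<alpha>'_def \<beta>'_def \<gamma>'_def
  have ST: "S ** T = vector [vector [\<alpha>, \<beta>], vector [\<beta>, \<gamma>]]"
    by (simp add: S T defs matrix_matrix_mult_def vec_eq_iff forall_2 sum_2 power2_eq_square mult.commute)
  have TS: "T ** S = vector [vector [\<alpha>', \<beta>'], vector [\<beta>', \<gamma>']]"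
    by (simp add: S T defs matrix_matrix_mult_def vec_eq_iff forall_2 sum_2 power2_eq_square mult.commute)
  have "\<alpha> * \<gamma> - \<beta> * \<beta> = (a * d - b * c)\<^sup>2" "\<alpha>' * \<gamma>' - \<beta>' * \<beta>' = (a * d - b * c)\<^sup>2"
    by (simp_all add: defs power2_eq_square algebra_simps)
  then have dets: "\<alpha> * \<gamma> - \<beta> * \<beta> \<noteq> 0" "\<alpha>' * \<gamma>' - \<beta>' * \<beta>' \<noteq> 0"
    using det by auto
  have ad: "a \<noteq> 0 \<or> d \<noteq> 0" and bc: "b \<noteq> c"
    using ne by auto
  have "a\<^sup>2 + d\<^sup>2 > 0"
    using ad by (simp add: sum_power2_gt_zero_iff)
  then have tr: "\<alpha> + \<gamma> \<ge> 1" "\<alpha>' + \<gamma>' \<ge> 1"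
    unfolding defs using zero_le_power2[of b] zero_le_power2[of c] by linarith+
  \<comment> \<open>Otherwise \<open>S\<close> is a rotation times a scalar, with determinant a^2 +
    b^2. Here a and b are nonzero, so this is at least 2.\<close>
  have "(a - d)\<^sup>2 + (b + c)\<^sup>2 \<noteq> 0"
  proof
    assume "(a - d)\<^sup>2 + (b + c)\<^sup>2 = 0"
    then have "d = a" "c = - b"
      by (simp_all add: sum_power2_eq_zero_iff)
    moreover from this have "a \<noteq> 0" "b \<noteq> 0"
      using ne by auto
    then have "a\<^sup>2 > 0" "b\<^sup>2 > 0"
      by simp_all
    ultimately show False
      using det by (simp add: power2_eq_square)
  qed
  moreover have "\<beta> * (\<gamma>' - \<alpha>') - \<beta>' * (\<gamma> - \<alpha>) = ((a + d) * (b - c)) * ((a - d)\<^sup>2 + (b + c)\<^sup>2)"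
    by (simp add: defs power2_eq_square algebra_simps)
  ultimately have indep: "\<beta> * (\<gamma>' - \<alpha>') - \<beta>' * (\<gamma> - \<alpha>) \<noteq> 0"
    using ne by simp
  from torus_rayleigh_increments_ge[OF ST TS dets tr indep]
  obtain \<kappa> W where \<kappa>: "\<kappa> > 0" and W: "W > 0" and incr: "\<And>n k. n > 0 \<Longrightarrow> reduce n k \<noteq> 0 \<Longrightarrow>
      (torus_rayleigh n \<alpha> \<beta> \<gamma> ((S ** T) *v k) - torus_rayleigh n \<alpha> \<beta> \<gamma> k)
        + (torus_rayleigh n \<alpha>' \<beta>' \<gamma>' ((T ** S) *v k) - torus_rayleigh n \<alpha>' \<beta>' \<gamma>' k)
      \<ge> \<kappa> - W * ((cmod (char_mod n (k $ 1) - 1))\<^sup>2 + (cmod (char_mod n (k $ 2) - 1))\<^sup>2)"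
    by metis
  define B where "B = 1 + real_of_int ((\<bar>\<alpha>\<bar> + \<bar>\<beta>\<bar> + \<bar>\<gamma>\<bar>) + (\<bar>\<alpha>'\<bar> + \<bar>\<beta>'\<bar> + \<bar>\<gamma>'\<bar>))"
  have B: "B > 0"
    by (simp add: B_def add_pos_nonneg)
  have bound: "\<bar>torus_rayleigh n \<alpha> \<beta> \<gamma> k\<bar> \<le> B" "\<bar>torus_rayleigh n \<alpha>' \<beta>' \<gamma>' k\<bar> \<le> B" for n k
    unfolding torus_rayleigh_def B_def by (rule order_trans[OF abs_sym_rayleigh_le], simp)+
  \<comment> \<open>With this choice the two terms \<open>B * (M / s)\<close> add up to half of
    \<kappa> \<open>M\<close>, which is absorbed into the left side; this gives the factor 2 in
    \<open>C\<close>.\<close>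
  define s where "s = 4 * B / \<kappa>"
  have s: "s > 0"
    using B \<kappa> by (simp add: s_def)
  have inv_ST: "(S ** T) ** (T' ** S') = mat 1" "(T' ** S') ** (S ** T) = mat 1"
    and inv_TS: "(T ** S) ** (S' ** T') = mat 1" "(S' ** T') ** (T ** S) = mat 1"
    using inv by (metis matrix_mul_assoc matrix_mul_rid)+
  define C where "C = 2 * (W + 4 * B * s) / \<kappa>"
  have C: "C > 0"
    using \<kappa> W B s by (simp add: C_def add_pos_pos)
  show ?thesis
  proof (intro exI[of _ C] conjI C allI impI)
    fix n :: nat and F :: "int^2 \<Rightarrow> complex"
    assume n: "n > 0" and "\<forall>k. F (reduce n k) = F k" and F0: "F 0 = 0"
    then have F: "F (reduce n k) = F k" for k
      by simp
    define M where "M = (\<Sum>k\<in>torus n. (cmod (F k))\<^sup>2)"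
    define E where "E A = (\<Sum>k\<in>torus n. (cmod (F (A *v k) - F k))\<^sup>2)" for A :: "int^2^2"
    define w where "w k = (cmod (char_mod n (k $ 1) - 1))\<^sup>2 + (cmod (char_mod n (k $ 2) - 1))\<^sup>2" for k :: "int^2"
    define U where "U = (\<Sum>k\<in>torus n. w k * (cmod (F k))\<^sup>2)"
    define D where "D k = torus_rayleigh n \<alpha> \<beta> \<gamma> ((S ** T) *v k) - torus_rayleigh n \<alpha> \<beta> \<gamma> k" for k
    define D' where "D' k = torus_rayleigh n \<alpha>' \<beta>' \<gamma>' ((T ** S) *v k) - torus_rayleigh n \<alpha>' \<beta>' \<gamma>' k" for k
    have E_nonneg: "E A \<ge> 0" for A
      by (simp add: E_def sum_nonneg)
    have U_nonneg: "U \<ge> 0"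
      by (simp add: U_def w_def sum_nonneg)
    have "\<kappa> * M - W * U = (\<Sum>k\<in>torus n. (\<kappa> - W * w k) * (cmod (F k))\<^sup>2)"
      by (simp add: M_def U_def left_diff_distrib sum_subtractf sum_distrib_left mult.assoc)
    also have "\<dots> \<le> (\<Sum>k\<in>torus n. (D k + D' k) * (cmod (F k))\<^sup>2)"
    proof (rule sum_mono)
      fix k assume "k \<in> torus n"
      show "(\<kappa> - W * w k) * (cmod (F k))\<^sup>2 \<le> (D k + D' k) * (cmod (F k))\<^sup>2"
      proof (cases "reduce n k = 0")
        \<comment> \<open>The increment bound excludes the origin, where the hypothesis
          \<open>F 0 = 0\<close> takes over.\<close>
        case True
        then have "F k = 0"
          using F[of k] F0 by simp
        then show ?thesis by simp
      next
        case False
        then show ?thesis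
          using incr[OF n False] by (intro mult_right_mono) (simp_all add: D_def D'_def w_def)
      qed
    qed
    also have "\<dots> = (\<Sum>k\<in>torus n. D k * (cmod (F k))\<^sup>2) + (\<Sum>k\<in>torus n. D' k * (cmod (F k))\<^sup>2)"
      by (simp add: ring_distribs sum.distrib)
    also have "\<dots> \<le> B * (s * E (S ** T) + M / s) + B * (s * E (T ** S) + M / s)"
      unfolding D_def D'_def E_def M_def
      by (intro add_mono sum_increment_le[where F = F, OF n inv_ST F] sum_increment_le[where F = F, OF n inv_TS F] bound s torus_rayleigh_reduce)
    also have "\<dots> \<le> B * (s * (2 * (E S + E T)) + M / s) + B * (s * (2 * (E T + E S)) + M / s)"
      using B s unfolding E_def
      by (intro add_mono mult_left_mono order_refl sum_product_defect_le[where F = F, OF n inv(3,4) F]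
          sum_product_defect_le[where F = F, OF n inv(1,2) F]) simp_all
    also have "\<dots> = 4 * B * s * (E S + E T) + \<kappa> / 2 * M"
      using B \<kappa> by (simp add: s_def field_simps)
    finally have "\<kappa> * M \<le> 2 * (W * U + 4 * B * s * (E S + E T))"
      by simp
    also have "\<dots> \<le> 2 * ((W + 4 * B * s) * (E S + E T + U))"
      using W B s E_nonneg U_nonneg by (simp add: ring_distribs)
    finally have "M \<le> C * (E S + E T + U)"
      using \<kappa> by (simp add: C_def field_simps)
    then show "(\<Sum>k\<in>torus n. (cmod (F k))\<^sup>2) \<le> C *
        (((\<Sum>k\<in>torus n. (cmod (F (S *v k) - F k))\<^sup>2) + (\<Sum>k\<in>torus n. (cmod (F (T *v k) - F k))\<^sup>2))
        + (\<Sum>k\<in>torus n. ((cmod (char_mod n (k $ 1) - 1))\<^sup>2 + (cmod (char_mod n (k $ 2) - 1))\<^sup>2) * (cmod (F k))\<^sup>2))"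
      by (simp only: M_def E_def U_def w_def)
  qed
qed

section \<open>From the dual torus back to the graphs\<close>

lemma det_invertible_int:
  fixes S :: "int^2^2"
  assumes "invertible S"
  shows "det S = 1 \<or> det S = - 1"
proof -
  have "det S * det (matrix_inv S) = 1"
    using matrix_inv_mult(1)[OF assms] by (metis det_I det_mul)
  then show ?thesis
    using zmult_eq_1_iff by blast
qed

lemma invertible_transpose_int:
  fixes S :: "int^2^2"
  assumes "invertible S"
  shows "invertible (transpose S)"
proof -
  have "transpose S ** transpose (matrix_inv S) = mat 1" "transpose (matrix_inv S) ** transpose S = mat 1"
    using matrix_inv_mult[OF assms] by (metis matrix_transpose_mul transpose_mat)+
  then show ?thesis
    by (auto simp: invertible_def)
qed

text \<open>The dual inequality is applied to the transform of a minimiser, which vanishes at 0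
  because the minimiser has sum zero. Four moves enter, each costing twice the edge energy; hence
  the 8 in the gap.\<close>

lemma expander_if_nondegenerate:
  fixes a b c d :: int
  assumes S: "S = vector [vector [a, b], vector [c, d]]" and inv: "invertible S"
    and ne: "(a + d) * (b - c) \<noteq> 0"
  shows "expander_family {2..} torus (\<lambda>n. torus_edges n S (transpose S))"
proof -
  define T where "T = transpose S"
  have T: "T = vector [vector [a, c], vector [b, d]]"
    by (simp add: T_def S transpose_def vec_eq_iff forall_2)
  have inv_T: "invertible T"
    unfolding T_def using inv by (rule invertible_transpose_int)
  note mi = matrix_inv_mult[OF inv] matrix_inv_mult[OF inv_T]
  have "a * d - b * c = 1 \<or> a * d - b * c = - 1"
    using det_invertible_int[OF inv] by (simp add: S det_2)
  from dual_spectral_gap[OF S T mi this ne]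
  obtain C where C: "C > 0" and gap: "\<forall>n>0. \<forall>F. (\<forall>k. F (reduce n k) = F k) \<longrightarrow> F 0 = 0 \<longrightarrow>
      (\<Sum>k\<in>torus n. (cmod (F k))\<^sup>2) \<le> C *
        (((\<Sum>k\<in>torus n. (cmod (F (S *v k) - F k))\<^sup>2) + (\<Sum>k\<in>torus n. (cmod (F (T *v k) - F k))\<^sup>2))
        + (\<Sum>k\<in>torus n. ((cmod (char_mod n (k $ 1) - 1))\<^sup>2 + (cmod (char_mod n (k $ 2) - 1))\<^sup>2) * (cmod (F k))\<^sup>2))"
    by (elim exE conjE)
  have "lambda2 (torus n) (torus_edges n S T) \<ge> 1 / (8 * C)" if "n \<ge> 2" for n
  proof -
    have n: "n > 0"
      using that by simp
    have "card (torus n) \<ge> 2"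
      using that self_le_power[of n 2] by (simp add: card_torus)
    from lambda2_attained(1)[OF finite_graph_torus[OF n] this]
    obtain f where f: "\<exists>u\<in>torus n. f u \<noteq> 0" "(\<Sum>u\<in>torus n. f u) = 0"
      "lambda2 (torus n) (torus_edges n S T) = rayleigh_quotient (torus n) (torus_edges n S T) f"
      by blast
    define E where "E = (\<Sum>e\<in>torus_edges n S T. edge_energy f e)"
    define F where "F = fourier n f"
    have dot_e: "dot k (vector [1, 0]) = k $ 1" "dot k (vector [0, 1]) = k $ 2" for k
      by (simp_all add: dot_def)
    have trans: "(\<Sum>k\<in>torus n. (cmod (char_mod n (dot k e) - 1))\<^sup>2 * (cmod (F k))\<^sup>2) \<le> real (n\<^sup>2) * (2 * E)"
      if "(\<lambda>v. v + e) \<in> moves S T" for e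
      unfolding F_def sum_translation_defect[OF n] E_def
      by (intro mult_left_mono sum_move_le[OF n that]) simp
    have matr: "(\<Sum>k\<in>torus n. (cmod (F (transpose B *v k) - F k))\<^sup>2) \<le> real (n\<^sup>2) * (2 * E)"
      if "(*v) A \<in> moves S T" "A ** B = mat 1" "B ** A = mat 1" for A B
      unfolding F_def sum_matrix_defect[OF n that(2,3)] E_def
      by (intro mult_left_mono sum_move_le[OF n that(1)]) simp
    have "real (n\<^sup>2) * (\<Sum>x\<in>torus n. (cmod (f x))\<^sup>2) = (\<Sum>k\<in>torus n. (cmod (F k))\<^sup>2)"
      by (simp add: F_def parseval[OF n])
    also have "\<dots> \<le> C *
        (((\<Sum>k\<in>torus n. (cmod (F (S *v k) - F k))\<^sup>2) + (\<Sum>k\<in>torus n. (cmod (F (T *v k) - F k))\<^sup>2))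
        + (\<Sum>k\<in>torus n. ((cmod (char_mod n (k $ 1) - 1))\<^sup>2 + (cmod (char_mod n (k $ 2) - 1))\<^sup>2) * (cmod (F k))\<^sup>2))"
      using n f(2) by (intro gap[rule_format]) (simp_all add: F_def fourier_0)
    also have "\<dots> \<le> C * ((real (n\<^sup>2) * (2 * E) + real (n\<^sup>2) * (2 * E)) + (real (n\<^sup>2) * (2 * E) + real (n\<^sup>2) * (2 * E)))"
    proof (intro mult_left_mono add_mono)
      \<comment> \<open>The inverse transpose of \<open>matrix_inv T\<close> is \<open>S\<close>, so
        the edges of \<open>matrix_inv T\<close> control the defect under \<open>S\<close>; the next
        case is symmetric.\<close>
      show "(\<Sum>k\<in>torus n. (cmod (F (S *v k) - F k))\<^sup>2) \<le> real (n\<^sup>2) * (2 * E)"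
        using matr[of "matrix_inv T" T] mi by (simp add: moves_def T_def)
      show "(\<Sum>k\<in>torus n. (cmod (F (T *v k) - F k))\<^sup>2) \<le> real (n\<^sup>2) * (2 * E)"
        using matr[of "matrix_inv S" S] mi by (simp add: moves_def T_def del: transpose_matrix_vector)
      show "(\<Sum>k\<in>torus n. ((cmod (char_mod n (k $ 1) - 1))\<^sup>2 + (cmod (char_mod n (k $ 2) - 1))\<^sup>2) * (cmod (F k))\<^sup>2)
          \<le> real (n\<^sup>2) * (2 * E) + real (n\<^sup>2) * (2 * E)"
        unfolding distrib_right sum.distrib
        by (intro add_mono trans[where e = "vector [1, 0]", unfolded dot_e]
            trans[where e = "vector [0, 1]", unfolded dot_e]) (simp_all add: moves_def)
    qed (use C in simp)
    also have "\<dots> = real (n\<^sup>2) * (8 * C * E)"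
      by (simp add: algebra_simps)
    finally have le: "(\<Sum>x\<in>torus n. (cmod (f x))\<^sup>2) \<le> 8 * C * E"
      using n by (simp add: mult_le_cancel_left)
    obtain u where u: "u \<in> torus n" "f u \<noteq> 0"
      using f(1) by blast
    have "(\<Sum>x\<in>torus n. (cmod (f x))\<^sup>2) > 0"
      by (rule sum_pos2[OF _ u(1)]) (use u(2) in auto)
    then show ?thesis
      using le C unfolding f(3) rayleigh_quotient_def E_def by (simp add: field_simps)
  qed
  then show ?thesis
    unfolding T_def[symmetric] expander_family_torus_iff[OF inv inv_T]
    using C by (intro exI[of _ "1 / (8 * C)"]) simp
qed

theorem theorem1p2:
  fixes S :: "int^2^2" and a b c d :: int
  assumes "S = vector [vector [a, b], vector [c, d]]"
    and "invertible S"
  shows "expander_family {2..} torus (\<lambda>n. torus_edges n S (transpose S))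
           \<longleftrightarrow> (a + d) * (b - c) \<noteq> 0"
proof
  assume exp: "expander_family {2..} torus (\<lambda>n. torus_edges n S (transpose S))"
  show "(a + d) * (b - c) \<noteq> 0"
  proof
    assume "(a + d) * (b - c) = 0"
    then consider "b = c" | "d = - a"
      by (auto simp: add_eq_0_iff)
    then show False
    proof cases
      case 1
      then have "transpose S = S"
        by (simp add: assms(1) transpose_def vec_eq_iff forall_2)
      then show False
        using not_expander_symmetric[OF assms(2)] exp by simp
    next
      case 2
      \<comment> \<open>For trace zero, Cayley-Hamilton makes the squares of \<open>S\<close> and of
        its transpose the scalar - det S, which is a unit.\<close>
      define \<sigma> where "\<sigma> = a * a + b * c"
      have "\<sigma> = - det S"
        by (simp add: \<sigma>_def assms(1) 2 det_2)
      then have "\<sigma> = 1 \<or> \<sigma> = - 1"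
        using det_invertible_int[OF assms(2)] by auto
      moreover have "S *v (S *v v) = \<sigma> *s v" "transpose S *v (transpose S *v v) = \<sigma> *s v" for v
        by (simp_all add: \<sigma>_def assms(1) 2 transpose_def matrix_vector_mult_def vec_eq_iff forall_2
            sum_2 algebra_simps)
      ultimately show False
        using not_expander_involutions[OF assms(2) invertible_transpose_int[OF assms(2)]] exp by blast
    qed
  qed
next
  assume "(a + d) * (b - c) \<noteq> 0"
  then show "expander_family {2..} torus (\<lambda>n. torus_edges n S (transpose S))"
    by (rule expander_if_nondegenerate[OF assms])
qed

end
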